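(* Assume the continuum hypothesis. Let $G$ be a topological group, $\mu$ a regular Borel probability measure on $G$, and $\phi : G \to \mathbb{R}$ a Borel measurable quasimorphism which is integrable with respect to $\mu$. Then there is a universally measurable quasimorphism $\widetilde{\phi} : G \to \mathbb{R}$ which is equivalent to $\phi$ and quasi-biharmonic with respect to $\mu$ in the sense that $\widetilde{\phi}$ is $\mu$-integrable and $$\int_G \widetilde{\phi}(gk)\, d\mu(k) = \int_G \widetilde{\phi}(kg)\, d\mu(k) = \widetilde{\phi}(g) + \ell_\mu(\phi) \qquad \text{for all } g \in G,$$ where $\ell_\mu(\phi)$ is the $\mu$-distortion of $\phi$.
   Context: A function $\phi : G \to \mathbb{R}$ is a quasimorphism if $\sup_{g,h \in G} |\phi(gh)-\phi(g)-\phi(h)| < \infty$. Two quasimorphisms are equivalent if their difference is uniformly bounded on $G$. For a $\mu$-integrable quasimorphism $\phi$, its $\mu$-distortion is $\ell_\mu(\phi) = \lim_{n\to\infty} \frac1n \int_G \phi \, d\mu^{*n}$, where $\mu^{*n}$ is the $n$-th convolution power of $\mu$. A subset $A$ of a measurable space $(Y,\mathcal{B})$ is universally measurable if it is measurable with respect to the completion of every finite measure on $\mathcal{B}$. A map between measurable spaces is universally measurable if preimages of universally measurable sets are universally measurable. Integrals of universally measurable functions are taken with respect to the completed measure. The $\sigma$-algebra on $G$ is the Borel $\sigma$-algebra. *)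

theory Defs
  imports "HOL-Probability.Probability" "HOL-Library.Equipollence"
begin

text \<open>
  Topological groups are rendered by the class \<^class>\<open>topological_group_add\<close>, which is written
  additively but assumes neither commutativity nor any separation axiom. Thus \<open>g + h\<close> is the group
  product, \<open>0\<close> the identity, and the order of summands matters throughout.
\<close>

definition continuum_hypothesis :: bool where
  "continuum_hypothesis \<longleftrightarrow> (\<forall>A :: real set. countable A \<or> A \<approx> (UNIV :: real set))"

definition quasimorphism :: "('a::group_add \<Rightarrow> real) \<Rightarrow> bool" where
  "quasimorphism \<phi> \<longleftrightarrow> bdd_above (range (\<lambda>(g, h). \<bar>\<phi> (g + h) - \<phi> g - \<phi> h\<bar>))"

definition equivalent_qm :: "('a \<Rightarrow> real) \<Rightarrow> ('a \<Rightarrow> real) \<Rightarrow> bool" where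
  "equivalent_qm \<phi> \<psi> \<longleftrightarrow> bdd_above (range (\<lambda>g. \<bar>\<phi> g - \<psi> g\<bar>))"

definition universally_measurable_sets :: "'a measure \<Rightarrow> 'a set set" where
  "universally_measurable_sets M =
     {A. \<forall>N. sets N = sets M \<longrightarrow> finite_measure N \<longrightarrow> A \<in> sets (completion N)}"

definition universally_measurable_map :: "'a measure \<Rightarrow> 'b measure \<Rightarrow> ('a \<Rightarrow> 'b) \<Rightarrow> bool" where
  "universally_measurable_map M N f \<longleftrightarrow>
     f \<in> space M \<rightarrow> space N \<and>
     (\<forall>B \<in> universally_measurable_sets N. f -` B \<inter> space M \<in> universally_measurable_sets M)"

text \<open>
  Regularity means outer regularity by open sets and inner regularity by compact sets, for all
  Borel sets. Borel measurability of the compact sets is only a restriction in non-Hausdorff spaces.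
\<close>
definition regular_borel_measure :: "'a::topological_space measure \<Rightarrow> bool" where
  "regular_borel_measure M \<longleftrightarrow>
     sets M = sets borel \<and>
     (\<forall>B \<in> sets borel.
        emeasure M B = (INF U \<in> {U. B \<subseteq> U \<and> open U}. emeasure M U) \<and>
        emeasure M B = (SUP K \<in> {K. K \<subseteq> B \<and> compact K \<and> K \<in> sets borel}. emeasure M K))"

text \<open>
  Multiplication need not be measurable with respect to the product of the Borel
  \<open>\<sigma>\<close>-algebras if the group is not second countable, so the convolution is not introduced as an image
  of \<open>M \<Otimes>\<^sub>M N\<close> but by its values on Borel sets. For regular \<open>N\<close> the integrand is Borel measurable
  and these values do form a measure, see the lemmas below.
\<close>
definition group_convolution ::
    "'a::topological_group_add measure \<Rightarrow> 'a measure \<Rightarrow> 'a measure" where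
  "group_convolution M N =
     measure_of UNIV (sets borel) (\<lambda>A. \<integral>\<^sup>+ g. emeasure N {h. g + h \<in> A} \<partial>M)"

primrec convolution_power :: "'a::topological_group_add measure \<Rightarrow> nat \<Rightarrow> 'a measure" where
  "convolution_power M 0 = return borel 0"
| "convolution_power M (Suc n) = group_convolution (convolution_power M n) M"

definition distortion :: "'a::topological_group_add measure \<Rightarrow> ('a \<Rightarrow> real) \<Rightarrow> real" where
  "distortion M \<phi> = lim (\<lambda>n. (1 / real n) * (\<integral>g. \<phi> g \<partial>convolution_power M n))"

lemma translate_borel:
  fixes A :: "'a::topological_group_add set"
  assumes "A \<in> sets borel"
  shows "{h. g + h \<in> A} \<in> sets borel"
proof -
  have "continuous_on UNIV (\<lambda>h. g + h)"
    unfolding continuous_on_def by (intro ballI tendsto_add tendsto_const tendsto_ident_at)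
  then have "(\<lambda>h. g + h) \<in> borel_measurable borel"
    by (rule borel_measurable_continuous_onI)
  from measurable_sets[OF this assms] show ?thesis by (simp add: vimage_def)
qed

lemma measurable_emeasure_translate:
  fixes N :: "'a::topological_group_add measure"
  assumes N: "prob_space N" "regular_borel_measure N" and A: "A \<in> sets borel"
  shows "(\<lambda>g. emeasure N {h. g + h \<in> A}) \<in> borel_measurable borel"
proof -
  interpret prob_space N by fact
  have sN [simp]: "sets N = sets borel" using N(2) by (simp add: regular_borel_measure_def)
  have spN [simp]: "space N = UNIV" using sets_eq_imp_space_eq[OF sN] by simp
  have tr: "{h. g + h \<in> A} \<in> sets N" if "A \<in> sets borel" for A and g :: 'a
    using translate_borel[OF that] by simp
  have op: "open {g. c < emeasure N {h. g + h \<in> U}}" if U: "open U" for U and c :: ennreal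
  proof (subst open_subopen, safe)
    fix g assume c: "c < emeasure N {h. g + h \<in> U}"
    have "emeasure N {h. g + h \<in> U} =
        (SUP K \<in> {K. K \<subseteq> {h. g + h \<in> U} \<and> compact K \<and> K \<in> sets borel}. emeasure N K)"
      using N(2)[unfolded regular_borel_measure_def, THEN conjunct2, rule_format,
          OF translate_borel[OF borel_open[OF U]], THEN conjunct2] .
    with c obtain K where K: "K \<subseteq> {h. g + h \<in> U}" "compact K" "K \<in> sets borel" "c < emeasure N K"
      by (auto simp: less_SUP_iff)
    have ad: "continuous_on UNIV (\<lambda>p::'a \<times> 'a. fst p + snd p)"
      unfolding continuous_on_def by (intro ballI tendsto_intros)
    have W: "open ((\<lambda>p::'a \<times> 'a. fst p + snd p) -` U)"
      using ad U by (simp add: open_vimage)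
    have "\<exists>V. open V \<and> g \<in> V \<and> V \<times> K \<subseteq> (\<lambda>p::'a \<times> 'a. fst p + snd p) -` U"
    proof -
      define S where "S = (\<lambda>p::'a \<times> 'a. fst p + snd p) -` U"
      have "\<exists>P Q. open P \<and> open Q \<and> g \<in> P \<and> k \<in> Q \<and> P \<times> Q \<subseteq> S" if "k \<in> K" for k
      proof -
        have "(g, k) \<in> S" using that K(1) by (auto simp: S_def)
        then obtain P Q where "open P" "open Q" "(g, k) \<in> P \<times> Q" "P \<times> Q \<subseteq> S"
          using open_prod_elim[OF W[folded S_def]] by metis
        then show ?thesis by (intro exI[of _ P] exI[of _ Q]) simp
      qed
      then obtain P Q where PQ: "\<And>k. k \<in> K \<Longrightarrow> open (P k)" "\<And>k. k \<in> K \<Longrightarrow> open (Q k)"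
          "\<And>k. k \<in> K \<Longrightarrow> g \<in> P k" "\<And>k. k \<in> K \<Longrightarrow> k \<in> Q k" "\<And>k. k \<in> K \<Longrightarrow> P k \<times> Q k \<subseteq> S"
        by metis
      obtain D where D: "D \<subseteq> K" "finite D" "K \<subseteq> (\<Union>k\<in>D. Q k)"
      proof (rule compactE_image[OF K(2), of K Q])
        show "\<And>k. k \<in> K \<Longrightarrow> open (Q k)" by (fact PQ(2))
        show "K \<subseteq> (\<Union>k\<in>K. Q k)" using PQ(4) by blast
      qed
      have "open (\<Inter>k\<in>D. P k)" using D PQ by (intro open_INT) auto
      moreover have "g \<in> (\<Inter>k\<in>D. P k)" using D PQ by auto
      moreover have "(\<Inter>k\<in>D. P k) \<times> K \<subseteq> (\<lambda>p::'a \<times> 'a. fst p + snd p) -` U"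
      proof safe
        fix v k assume v: "v \<in> (\<Inter>k\<in>D. P k)" and "k \<in> K"
        then obtain d where d: "d \<in> D" "k \<in> Q d" using D(3) by blast
        then have "(v, k) \<in> P d \<times> Q d" using v by simp
        then have "(v, k) \<in> S" using PQ(5)[of d] d(1) D(1) by blast
        then show "(v, k) \<in> (\<lambda>p::'a \<times> 'a. fst p + snd p) -` U" by (simp only: S_def)
      qed
      ultimately show ?thesis by (intro exI[of _ "\<Inter>k\<in>D. P k"] conjI)
    qed
    then obtain V where V: "open V" "g \<in> V" "V \<times> K \<subseteq> (\<lambda>p::'a \<times> 'a. fst p + snd p) -` U"
      by blast
    have "V \<subseteq> {g. c < emeasure N {h. g + h \<in> U}}"
    proof
      fix v assume "v \<in> V"
      then have "K \<subseteq> {h. v + h \<in> U}" using V(3) by auto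
      then have "emeasure N K \<le> emeasure N {h. v + h \<in> U}"
        using U by (intro emeasure_mono tr) auto
      then show "v \<in> {g. c < emeasure N {h. g + h \<in> U}}" using K(4) by auto
    qed
    with V show "\<exists>T. open T \<and> g \<in> T \<and> T \<subseteq> {g. c < emeasure N {h. g + h \<in> U}}" by blast
  qed
  have "A \<in> sigma_sets UNIV (Collect open)" using A by (simp add: borel_def)
  then show ?thesis
  proof (induction rule: sigma_sets_induct_disjoint[rotated 2, consumes 1, case_names basic empty compl union])
    case (basic U)
    show ?case
      using op[of U] basic by (intro borel_measurableI_greater) simp
  next
    case empty
    then show ?case by simp
  next
    case (compl B)
    have B: "B \<in> sets borel" using compl(1) by (simp add: borel_def)
    have "emeasure N {h. g + h \<in> UNIV - B} = 1 - emeasure N {h. g + h \<in> B}" for g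
    proof -
      have "{h. g + h \<in> UNIV - B} = space N - {h. g + h \<in> B}" by auto
      then show ?thesis using emeasure_compl[OF tr[OF B, of g]] emeasure_space_1 by simp
    qed
    then show ?case using compl(2) by simp
  next
    case (union B)
    have B: "B i \<in> sets borel" for i using union(2) by (auto simp: borel_def)
    have "emeasure N {h. g + h \<in> \<Union>(range B)} = (\<Sum>i. emeasure N {h. g + h \<in> B i})" for g
    proof -
      have "(\<Sum>i. emeasure N {h. g + h \<in> B i}) = emeasure N (\<Union>i. {h. g + h \<in> B i})"
        using union(1) tr[OF B] by (intro suminf_emeasure) (auto simp: disjoint_family_on_def)
      moreover have "(\<Union>i. {h. g + h \<in> B i}) = {h. g + h \<in> \<Union>(range B)}" by auto
      ultimately show ?thesis by simp
    qed
    then show ?case using union(3) by simp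
  qed (auto simp: Int_stable_def)
qed

lemma space_group_convolution [simp]: "space (group_convolution M N) = UNIV"
  and sets_group_convolution [simp]: "sets (group_convolution M N) = sets borel"
  using sets.sigma_sets_eq[of borel] sets.space_closed[of borel]
  by (simp_all add: group_convolution_def sets_measure_of space_measure_of)

lemma emeasure_group_convolution:
  fixes M N :: "'a::topological_group_add measure"
  assumes M: "sets M = sets borel" and N: "prob_space N" "regular_borel_measure N"
    and A: "A \<in> sets borel"
  shows "emeasure (group_convolution M N) A = (\<integral>\<^sup>+ g. emeasure N {h. g + h \<in> A} \<partial>M)"
proof -
  have sN [simp]: "sets N = sets borel" using N(2) by (simp add: regular_borel_measure_def)
  have mM: "f \<in> borel_measurable borel \<Longrightarrow> f \<in> borel_measurable M" for f :: "'a \<Rightarrow> ennreal"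
    using M by (metis measurable_cong_sets)
  show ?thesis
    unfolding group_convolution_def
  proof (rule emeasure_measure_of_sigma)
    show "sigma_algebra UNIV (sets (borel :: 'a measure))"
      using sets.sigma_algebra_axioms[of borel] by simp
    show "positive (sets (borel :: 'a measure)) (\<lambda>A. \<integral>\<^sup>+ g. emeasure N {h. g + h \<in> A} \<partial>M)"
      by (simp add: positive_def)
    show "countably_additive (sets (borel :: 'a measure)) (\<lambda>A. \<integral>\<^sup>+ g. emeasure N {h. g + h \<in> A} \<partial>M)"
    proof (rule countably_additiveI)
      fix B :: "nat \<Rightarrow> 'a set"
      assume B: "range B \<subseteq> sets borel" "disjoint_family B"
      have un: "(\<Sum>i. emeasure N {h. g + h \<in> B i}) = emeasure N {h. g + h \<in> \<Union>(range B)}" for g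
      proof -
        have "(\<Sum>i. emeasure N {h. g + h \<in> B i}) = emeasure N (\<Union>i. {h. g + h \<in> B i})"
          using B translate_borel[of "B _" g]
          by (intro suminf_emeasure) (auto simp: disjoint_family_on_def)
        moreover have "(\<Union>i. {h. g + h \<in> B i}) = {h. g + h \<in> \<Union>(range B)}" by auto
        ultimately show ?thesis by simp
      qed
      have "(\<Sum>i. \<integral>\<^sup>+ g. emeasure N {h. g + h \<in> B i} \<partial>M)
          = (\<integral>\<^sup>+ g. (\<Sum>i. emeasure N {h. g + h \<in> B i}) \<partial>M)"
        using B by (intro nn_integral_suminf[symmetric] mM measurable_emeasure_translate N) auto
      also have "\<dots> = (\<integral>\<^sup>+ g. emeasure N {h. g + h \<in> \<Union>(range B)} \<partial>M)"
        by (simp only: un)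
      finally show "(\<Sum>i. \<integral>\<^sup>+ g. emeasure N {h. g + h \<in> B i} \<partial>M)
          = (\<integral>\<^sup>+ g. emeasure N {h. g + h \<in> \<Union>(range B)} \<partial>M)" .
    qed
  qed (fact A)
qed

end

theory Submission
  imports Defs
begin

text \<open>
  Averaging over \<open>\<mu>\<close> on the right, \<open>P f g = \<integral>k. f (g + k) \<partial>\<mu>\<close>, and on the left,
  \<open>Q f g = \<integral>k. f (k + g) \<partial>\<mu>\<close>, maps the functions at bounded distance from \<open>\<phi>\<close> to themselves. The
  numbers \<open>\<integral>\<phi> \<partial>\<mu>\<^sup>n = (P ^^ n) \<phi> 0\<close> form a sequence that is additive up to the defect of \<open>\<phi>\<close>, so
  they stay at bounded distance from \<open>n l\<close>, where \<open>l\<close> is the distortion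
  (\<open>quasi_additive_sequence\<close>). Hence all powers of \<open>T = P - l\<close> and of \<open>S = Q - l\<close> move a function that is
  close to \<open>\<phi>\<close> by a bounded amount only, and the required function is a common fixed point of
  \<open>T\<close> and \<open>S\<close>.

  The operators \<open>T\<close> and \<open>S\<close> are monotone, respect pointwise limits of uniformly close functions, and
  commute. For such operators a common fixed point is reached through upper limits and increasing
  limits of sequences, and so it is a Borel function
  (\<open>commuting_drift_operators_common_fixpoint\<close>). By Fatou's lemma, \<open>u = limsup (T ^^ n) \<phi>\<close> satisfies
  \<open>u \<le> T u\<close>. Since \<open>S\<close> commutes with \<open>T\<close>, each \<open>(S ^^ n) u\<close> inherits this inequality, so
  \<open>v = limsup (S ^^ n) u\<close> satisfies both \<open>v \<le> S v\<close> and \<open>v \<le> T v\<close>. Now \<open>(S ^^ n) v\<close> increases to a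
  fixed point \<open>w\<close> of \<open>S\<close> with \<open>w \<le> T w\<close>, and \<open>(T ^^ n) w\<close> increases to a fixed point of \<open>T\<close>, which
  is still fixed by \<open>S\<close>.

  That \<open>P\<close> and \<open>Q\<close> preserve Borel functions and commute is a statement of Fubini's type. By continuity
  of the group operation, \<open>f (h + g + k)\<close> is a Borel function of \<open>(h, k)\<close> on the product space, but
  without second countability it may fail to be measurable for the product \<open>\<sigma>\<close>-algebra. Regularity
  of \<open>\<mu>\<close> bridges the gap: an open set contains a countable union of measurable rectangles that fills
  almost all of its sections up to null sets (\<open>open_almost_product_measurable\<close>), and from there
  Fubini's theorem extends to all Borel functions on the product space (\<open>fubini_regular_borel\<close>).
\<close>

section \<open>Regular measures and universal measurability\<close>

lemma regular_borel_measure_sets: "regular_borel_measure M \<Longrightarrow> sets M = sets borel"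
  by (simp add: regular_borel_measure_def)

lemma regular_borel_measure_space: "regular_borel_measure M \<Longrightarrow> space M = UNIV"
  using sets_eq_imp_space_eq[OF regular_borel_measure_sets] by simp

lemma measurable_Pair_borel:
  "Pair x \<in> borel_measurable borel" "(\<lambda>x. (x, y)) \<in> borel_measurable borel"
  for x :: "'a::topological_space" and y :: "'b::topological_space"
  by (intro borel_measurable_continuous_onI continuous_intros)+

lemma regular_borel_measure_inner:
  assumes "regular_borel_measure M" "B \<in> sets borel"
  shows "emeasure M B = (SUP K \<in> {K. K \<subseteq> B \<and> compact K \<and> K \<in> sets borel}. emeasure M K)"
  using assms unfolding regular_borel_measure_def by blast

lemma regular_borel_measure_inner_compact:
  assumes M: "regular_borel_measure M" and B: "B \<in> sets borel" and c: "c < emeasure M B"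
  obtains K where "compact K" "K \<in> sets borel" "K \<subseteq> B" "c < emeasure M K"
proof -
  have "emeasure M B = (SUP K \<in> {K. K \<subseteq> B \<and> compact K \<and> K \<in> sets borel}. emeasure M K)"
    by (rule regular_borel_measure_inner[OF M B])
  with c show thesis using that by (auto simp: less_SUP_iff)
qed

lemma regular_borel_measure_sigma_compact:
  assumes M: "regular_borel_measure M" "finite_measure M" and B: "B \<in> sets borel"
  obtains K :: "nat \<Rightarrow> 'a::topological_space set"
  where "\<And>n. compact (K n)" "\<And>n. K n \<in> sets borel" "\<And>n. K n \<subseteq> B"
    "AE x in M. x \<in> B \<longrightarrow> (\<exists>n. x \<in> K n)"
proof -
  interpret finite_measure M by fact
  note [simp] = regular_borel_measure_sets[OF M(1)]
  let ?\<K> = "{K. K \<subseteq> B \<and> compact K \<and> K \<in> sets borel}"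
  have eq: "emeasure M B = (SUP K \<in> ?\<K>. emeasure M K)"
    by (rule regular_borel_measure_inner[OF M(1) B])
  have ne: "?\<K> \<noteq> {}" by (auto intro!: exI[of _ "{}"])
  obtain f :: "nat \<Rightarrow> ennreal" where f: "range f \<subseteq> emeasure M ` ?\<K>" "emeasure M B = (SUP n. f n)"
    using ennreal_SUP_countable_SUP[OF ne, of "emeasure M"] eq by auto
  have "\<forall>n. \<exists>K. K \<in> ?\<K> \<and> f n = emeasure M K" using f(1) by blast
  then obtain K where K: "\<And>n. K n \<in> ?\<K>" "\<And>n. f n = emeasure M (K n)" by metis
  have UK: "(\<Union>n. K n) \<in> sets borel" using K by auto
  have "emeasure M B \<le> emeasure M (\<Union>n. K n)"
    unfolding f(2) K(2) using UK by (intro SUP_least emeasure_mono) auto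
  then have "emeasure M (B - (\<Union>n. K n)) = 0"
    using K UK B by (subst emeasure_Diff) (auto simp: diff_eq_0_iff_ennreal less_top[symmetric])
  then have "AE x in M. x \<notin> B - (\<Union>n. K n)"
    using UK B by (intro AE_not_in) (auto simp: null_sets_def)
  then have "AE x in M. x \<in> B \<longrightarrow> (\<exists>n. x \<in> K n)" by eventually_elim auto
  then show thesis using K(1) by (intro that[of K]) auto
qed

text \<open>
  A finite measure on \<open>M\<close> is pushed forward to \<open>N\<close>; null sets of the image have null preimages.
\<close>
lemma measurable_imp_universally_measurable_map:
  assumes f: "f \<in> M \<rightarrow>\<^sub>M N"
  shows "universally_measurable_map M N f"
  unfolding universally_measurable_map_def
proof (intro conjI ballI)
  show "f \<in> space M \<rightarrow> space N" using measurable_space[OF f] by auto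
  fix B assume B: "B \<in> universally_measurable_sets N"
  show "f -` B \<inter> space M \<in> universally_measurable_sets M"
    unfolding universally_measurable_sets_def
  proof (intro CollectI allI impI)
    fix L :: "'a measure" assume L: "sets L = sets M" "finite_measure L"
    have sp: "space L = space M" by (rule sets_eq_imp_space_eq[OF L(1)])
    have fL: "f \<in> L \<rightarrow>\<^sub>M N" using f measurable_cong_sets[OF L(1) refl] by blast
    have "finite_measure (distr L N f)" by (rule finite_measure.finite_measure_distr[OF L(2) fL])
    then have "B \<in> sets (completion (distr L N f))"
      using B by (simp add: universally_measurable_sets_def)
    then obtain S Z Z' where S: "B = S \<union> Z" "S \<in> sets N" "Z \<subseteq> Z'" "Z' \<in> null_sets (distr L N f)"
      by (auto elim!: sets_completionE)
    show "f -` B \<inter> space M \<in> sets (completion L)"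
    proof (rule sets_completionI)
      show "f -` B \<inter> space M = (f -` S \<inter> space L) \<union> (f -` Z \<inter> space L)" using S(1) sp by auto
      show "f -` Z \<inter> space L \<subseteq> f -` Z' \<inter> space L" using S(3) by auto
      show "f -` Z' \<inter> space L \<in> null_sets L" using S(4) fL by (simp add: null_sets_distr_iff)
      show "f -` S \<inter> space L \<in> sets L" using fL S(2) by (rule measurable_sets)
    qed
  qed
qed

section \<open>Tonelli and Fubini on the Borel sets of a product space\<close>

text \<open>
  Inner regularity finds a compact \<open>C\<close> in the section, and the tube lemma thickens \<open>{x} \<times> C\<close> inside
  \<open>W\<close>. As \<open>C\<close> itself is Borel, the tube is a measurable rectangle.
\<close>
lemma section_of_open_contains_compact_tube:
  fixes W :: "('a::topological_space \<times> 'b::topological_space) set"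
  assumes N: "regular_borel_measure N" and W: "open W" and p: "p < emeasure N (Pair x -` W)"
  obtains V C where "open V" "x \<in> V" "compact C" "C \<in> sets borel" "V \<times> C \<subseteq> W" "p < emeasure N C"
proof -
  have "Pair x -` W \<in> sets borel"
    using measurable_sets[OF measurable_Pair_borel(1), of W x] W by simp
  then obtain C where C: "compact C" "C \<in> sets borel" "C \<subseteq> Pair x -` W" "p < emeasure N C"
    using regular_borel_measure_inner_compact[OF N _ p] by metis
  then have "{x} \<times> C \<subseteq> W" by auto
  then obtain V where "x \<in> V" "open V" "V \<times> C \<subseteq> W"
    using Elementary_Topology.tube_lemma[OF C(1) W] by metis
  with C show thesis by (intro that)
qed

lemma sections_emeasure_mono:
  fixes W :: "('a::topological_space \<times> 'b::topological_space) set"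
  assumes "sets N = sets borel" "W \<in> sets borel" "V \<times> C \<subseteq> W" "x \<in> V"
  shows "emeasure N C \<le> emeasure N (Pair x -` W)"
  using assms measurable_sets[OF measurable_Pair_borel(1), of W x] by (intro emeasure_mono) auto

lemma lower_semicontinuous_sections:
  fixes W :: "('a::topological_space \<times> 'b::topological_space) set"
  assumes N: "regular_borel_measure N" and W: "open W"
  shows "open {x. p < emeasure N (Pair x -` W)}"
proof (subst open_subopen, safe)
  fix x assume "p < emeasure N (Pair x -` W)"
  then obtain V C where V: "open V" "x \<in> V" "compact C" "C \<in> sets borel" "V \<times> C \<subseteq> W" "p < emeasure N C"
    by (rule section_of_open_contains_compact_tube[OF N W])
  have "emeasure N C \<le> emeasure N (Pair v -` W)" if "v \<in> V" for v
    using sections_emeasure_mono[OF regular_borel_measure_sets[OF N] _ V(5) that] W by simp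
  then have "V \<subseteq> {x. p < emeasure N (Pair x -` W)}"
    using V(6) by (auto intro: less_le_trans)
  with V show "\<exists>T. open T \<and> x \<in> T \<and> T \<subseteq> {x. p < emeasure N (Pair x -` W)}" by blast
qed

text \<open>
  Finitely many of the tubes above have bases that cover \<open>K\<close>.
\<close>
lemma compact_level_set_rectangles:
  fixes W :: "('a::topological_space \<times> 'b::topological_space) set"
  assumes N: "regular_borel_measure N" and W: "open W"
    and K: "compact K" "K \<subseteq> {x. p < emeasure N (Pair x -` W)}"
  shows "\<exists>R \<in> sets (borel \<Otimes>\<^sub>M borel). R \<subseteq> W \<and> (\<forall>x\<in>K. p < emeasure N (Pair x -` R))"
proof -
  have "\<forall>x\<in>K. \<exists>V C. open V \<and> x \<in> V \<and> C \<in> sets borel \<and> V \<times> C \<subseteq> W \<and> p < emeasure N C"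
    using K(2) section_of_open_contains_compact_tube[OF N W] by (metis mem_Collect_eq subsetD)
  then obtain V C where VC: "\<And>x. x \<in> K \<Longrightarrow> open (V x)" "\<And>x. x \<in> K \<Longrightarrow> x \<in> V x"
      "\<And>x. x \<in> K \<Longrightarrow> C x \<in> sets borel" "\<And>x. x \<in> K \<Longrightarrow> V x \<times> C x \<subseteq> W"
      "\<And>x. x \<in> K \<Longrightarrow> p < emeasure N (C x)"
    by metis
  obtain D where D: "D \<subseteq> K" "finite D" "K \<subseteq> (\<Union>x\<in>D. V x)"
    using compactE_image[OF K(1), of K V] VC(1,2) by (metis UN_I subsetI)
  let ?R = "\<Union>d\<in>D. V d \<times> C d"
  have R: "?R \<in> sets (borel \<Otimes>\<^sub>M borel)"
    using D VC by (intro sets.finite_UN pair_measureI) auto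
  moreover have "?R \<subseteq> W" using VC(4) D(1) by auto
  moreover have "p < emeasure N (Pair x -` ?R)" if x: "x \<in> K" for x
  proof -
    obtain d where d: "d \<in> D" "x \<in> V d" using D(3) x by blast
    have "Pair x -` ?R \<in> sets N"
      using sets_Pair1[OF R, of x] regular_borel_measure_sets[OF N] by simp
    then have "emeasure N (C d) \<le> emeasure N (Pair x -` ?R)"
      using d by (intro emeasure_mono) auto
    then show ?thesis using VC(5)[of d] d(1) D(1) by (auto intro: less_le_trans)
  qed
  ultimately show ?thesis by blast
qed

text \<open>
  For each rational \<open>p\<close>, almost all of the open set of points whose section has measure above \<open>p\<close> is
  covered by countably many compact sets, and over each of these a finite union of rectangles
  already has sections of measure above \<open>p\<close>. Collecting all these rectangles, countably many, gives
  \<open>R\<close>.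
\<close>
lemma open_almost_product_measurable:
  fixes W :: "('a::topological_space \<times> 'b::topological_space) set"
  assumes M: "regular_borel_measure M" "finite_measure M"
    and N: "regular_borel_measure N" and W: "open W"
  obtains R where "R \<in> sets (borel \<Otimes>\<^sub>M borel)" "R \<subseteq> W"
    "AE x in M. emeasure N (Pair x -` W) \<le> emeasure N (Pair x -` R)"
proof -
  let ?U = "\<lambda>p::rat. {x. ennreal (of_rat p) < emeasure N (Pair x -` W)}"
  have "\<forall>p. \<exists>K :: nat \<Rightarrow> 'a set. (\<forall>n. compact (K n) \<and> K n \<subseteq> ?U p)
      \<and> (AE x in M. x \<in> ?U p \<longrightarrow> (\<exists>n. x \<in> K n))"
  proof
    fix p
    have "?U p \<in> sets borel" using lower_semicontinuous_sections[OF N W] by simp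
    then obtain K :: "nat \<Rightarrow> 'a set" where "\<And>n. compact (K n)" "\<And>n. K n \<in> sets borel"
        "\<And>n. K n \<subseteq> ?U p" "AE x in M. x \<in> ?U p \<longrightarrow> (\<exists>n. x \<in> K n)"
      by (rule regular_borel_measure_sigma_compact[OF M]) (rule that)
    then show "\<exists>K :: nat \<Rightarrow> 'a set. (\<forall>n. compact (K n) \<and> K n \<subseteq> ?U p)
      \<and> (AE x in M. x \<in> ?U p \<longrightarrow> (\<exists>n. x \<in> K n))" by blast
  qed
  from choice[OF this] obtain K :: "rat \<Rightarrow> nat \<Rightarrow> 'a set" where K: "\<And>p n. compact (K p n)" "\<And>p n. K p n \<subseteq> ?U p"
      "\<And>p. AE x in M. x \<in> ?U p \<longrightarrow> (\<exists>n. x \<in> K p n)" by blast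
  obtain R where R: "\<And>p n. R p n \<in> sets (borel \<Otimes>\<^sub>M borel)" "\<And>p n. R p n \<subseteq> W"
      "\<And>p n x. x \<in> K p n \<Longrightarrow> ennreal (of_rat p) < emeasure N (Pair x -` R p n)"
    using compact_level_set_rectangles[OF N W K(1,2)] by metis
  define S where "S = (\<Union>p. \<Union>n. R p n)"
  have S: "S \<in> sets (borel \<Otimes>\<^sub>M borel)" unfolding S_def using R(1) by blast
  have "AE x in M. \<forall>p. x \<in> ?U p \<longrightarrow> (\<exists>n. x \<in> K p n)"
    unfolding AE_all_countable using K(3) by blast
  then have "AE x in M. emeasure N (Pair x -` W) \<le> emeasure N (Pair x -` S)"
  proof eventually_elim
    case (elim x)
    show ?case
    proof (rule ccontr)
      assume "\<not> ?thesis"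
      then obtain p :: rat where p: "emeasure N (Pair x -` S) < ennreal (of_rat p)"
          "ennreal (of_rat p) < emeasure N (Pair x -` W)"
        using ennreal_rat_dense not_le by metis
      then obtain n where "x \<in> K p n" using elim by blast
      then have "ennreal (of_rat p) < emeasure N (Pair x -` R p n)" by (rule R(3))
      also have "\<dots> \<le> emeasure N (Pair x -` S)"
        using sets_Pair1[OF S, of x] regular_borel_measure_sets[OF N]
        by (intro emeasure_mono) (auto simp: S_def)
      finally show False using p(1) by simp
    qed
  qed
  then show thesis using S R(2) by (intro that[of S]) (auto simp: S_def)
qed

text \<open>
  The set \<open>R\<close> of the previous lemma obeys the classical Tonelli theorem; almost
  all its sections over \<open>M\<close> have full measure in those of \<open>W\<close>, and its sections over \<open>N\<close> are
  contained in those of \<open>W\<close>. Equality then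
  follows by exchanging the factors.
\<close>
lemma tonelli_open_le:
  fixes W :: "('a::topological_space \<times> 'b::topological_space) set"
  assumes M: "regular_borel_measure M" "finite_measure M"
    and N: "regular_borel_measure N" "finite_measure N" and W: "open W"
  shows "(\<integral>\<^sup>+x. emeasure N (Pair x -` W) \<partial>M) \<le> (\<integral>\<^sup>+y. emeasure M ((\<lambda>x. (x, y)) -` W) \<partial>N)"
proof -
  interpret M: finite_measure M by fact
  interpret N: finite_measure N by fact
  interpret pair_sigma_finite M N ..
  obtain R where R: "R \<in> sets (borel \<Otimes>\<^sub>M borel)" "R \<subseteq> W"
      "AE x in M. emeasure N (Pair x -` W) \<le> emeasure N (Pair x -` R)"
    by (rule open_almost_product_measurable[OF M N(1) W])
  have R': "R \<in> sets (M \<Otimes>\<^sub>M N)"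
    using R(1) M N by (simp add: regular_borel_measure_sets cong: sets_pair_measure_cong)
  have "(\<integral>\<^sup>+x. emeasure N (Pair x -` W) \<partial>M) \<le> (\<integral>\<^sup>+x. emeasure N (Pair x -` R) \<partial>M)"
    by (intro nn_integral_mono_AE R(3))
  also have "\<dots> = (\<integral>\<^sup>+y. emeasure M ((\<lambda>x. (x, y)) -` R) \<partial>N)"
    using emeasure_pair_measure_alt2[OF R'] N.emeasure_pair_measure_alt[OF R'] by simp
  also have "\<dots> \<le> (\<integral>\<^sup>+y. emeasure M ((\<lambda>x. (x, y)) -` W) \<partial>N)"
    using R(2) measurable_sets[OF measurable_Pair_borel(2), of W] W
    by (intro nn_integral_mono emeasure_mono) (auto simp: regular_borel_measure_sets[OF M(1)])
  finally show ?thesis .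
qed

lemma tonelli_open:
  fixes W :: "('a::topological_space \<times> 'b::topological_space) set"
  assumes M: "regular_borel_measure M" "finite_measure M"
    and N: "regular_borel_measure N" "finite_measure N" and W: "open W"
  shows "(\<integral>\<^sup>+x. emeasure N (Pair x -` W) \<partial>M) = (\<integral>\<^sup>+y. emeasure M ((\<lambda>x. (x, y)) -` W) \<partial>N)"
proof (rule antisym)
  have "open (prod.swap -` W)"
    using W by (intro open_vimage continuous_on_swap)
  from tonelli_open_le[OF N M this]
  show "(\<integral>\<^sup>+y. emeasure M ((\<lambda>x. (x, y)) -` W) \<partial>N) \<le> (\<integral>\<^sup>+x. emeasure N (Pair x -` W) \<partial>M)"
    by (simp add: vimage_def)
qed (rule tonelli_open_le[OF M N W])

lemma borel_eq_sigma_sets_open: "sets (borel :: 'a::topological_space measure) = sigma_sets UNIV {S. open S}"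
  by (simp add: borel_def)

lemma measurable_emeasure_section:
  fixes A :: "('a::topological_space \<times> 'b::topological_space) set"
  assumes N: "regular_borel_measure N" "finite_measure N" and A: "A \<in> sets borel"
  shows "(\<lambda>x. emeasure N (Pair x -` A)) \<in> borel_measurable borel"
proof -
  interpret finite_measure N by fact
  note [simp] = regular_borel_measure_sets[OF N(1)] regular_borel_measure_space[OF N(1)]
  have s: "Pair x -` B \<in> sets borel" if "B \<in> sets borel" for B :: "('a \<times> 'b) set" and x
    using measurable_sets[OF measurable_Pair_borel(1) that, of x] by simp
  have "Int_stable {S :: ('a \<times> 'b) set. open S}" "{S :: ('a \<times> 'b) set. open S} \<subseteq> Pow UNIV"
    by (auto simp: Int_stable_def)
  from this A[unfolded borel_eq_sigma_sets_open] show ?thesis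
  proof (induction rule: sigma_sets_induct_disjoint)
    case (basic W)
    then show ?case
      by (auto intro!: borel_measurableI_greater borel_open lower_semicontinuous_sections[OF N(1)])
  next
    case (compl B)
    then have B: "B \<in> sets borel" by (simp add: borel_eq_sigma_sets_open)
    have "emeasure N (Pair x -` (UNIV - B)) = emeasure N (space N) - emeasure N (Pair x -` B)" for x
      using emeasure_compl[of "Pair x -` B" N] s[OF B] by (simp add: vimage_Diff)
    then show ?case using compl(2) by simp
  next
    case (union B)
    then have B: "B i \<in> sets borel" for i by (auto simp: borel_eq_sigma_sets_open)
    have "emeasure N (Pair x -` (\<Union>i. B i)) = (\<Sum>i. emeasure N (Pair x -` B i))" for x
      using union(1) s[OF B] unfolding vimage_UN
      by (intro suminf_emeasure[symmetric]) (auto simp: disjoint_family_on_def)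
    then show ?case using union(3) by simp
  qed simp
qed

lemma tonelli_borel_set:
  fixes A :: "('a::topological_space \<times> 'b::topological_space) set"
  assumes M: "regular_borel_measure M" "finite_measure M"
    and N: "regular_borel_measure N" "finite_measure N" and A: "A \<in> sets borel"
  shows "(\<integral>\<^sup>+x. emeasure N (Pair x -` A) \<partial>M) = (\<integral>\<^sup>+y. emeasure M ((\<lambda>x. (x, y)) -` A) \<partial>N)"
proof -
  interpret M: finite_measure M by fact
  interpret N: finite_measure N by fact
  note [simp] = regular_borel_measure_sets[OF N(1)] regular_borel_measure_space[OF N(1)]
    regular_borel_measure_sets[OF M(1)] regular_borel_measure_space[OF M(1)]
  have s: "Pair x -` B \<in> sets borel" "(\<lambda>x. (x, y)) -` B \<in> sets borel"
    if "B \<in> sets borel" for B :: "('a \<times> 'b) set" and x y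
    using measurable_sets[OF measurable_Pair_borel(1) that, of x]
      measurable_sets[OF measurable_Pair_borel(2) that, of y] by simp_all
  have mN: "(\<lambda>x. emeasure N (Pair x -` B)) \<in> borel_measurable M" if "B \<in> sets borel"
    for B :: "('a \<times> 'b) set"
    using measurable_emeasure_section[OF N that] by (simp cong: measurable_cong_sets)
  have mM: "(\<lambda>y. emeasure M ((\<lambda>x. (x, y)) -` B)) \<in> borel_measurable N" if B: "B \<in> sets borel"
    for B :: "('a \<times> 'b) set"
  proof -
    have "(prod.swap :: 'b \<times> 'a \<Rightarrow> _) \<in> borel_measurable borel"
      by (intro borel_measurable_continuous_onI continuous_on_swap)
    from measurable_emeasure_section[OF M, of "prod.swap -` B"] measurable_sets[OF this B]
    show ?thesis by (simp add: vimage_def cong: measurable_cong_sets)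
  qed
  have "Int_stable {S :: ('a \<times> 'b) set. open S}" "{S :: ('a \<times> 'b) set. open S} \<subseteq> Pow UNIV"
    by (auto simp: Int_stable_def)
  from this A[unfolded borel_eq_sigma_sets_open] show ?thesis
  proof (induction rule: sigma_sets_induct_disjoint)
    case (basic W)
    then show ?case using tonelli_open[OF M N] by simp
  next
    case (compl B)
    then have B: "B \<in> sets borel" by (simp add: borel_eq_sigma_sets_open)
    have leN: "emeasure N (Pair x -` B) \<le> emeasure N UNIV" for x
      by (intro emeasure_mono) auto
    have leM: "emeasure M ((\<lambda>x. (x, y)) -` B) \<le> emeasure M UNIV" for y
      by (intro emeasure_mono) auto
    have fin: "(\<integral>\<^sup>+x. emeasure N (Pair x -` B) \<partial>M) \<noteq> \<infinity>"
    proof -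
      have "(\<integral>\<^sup>+x. emeasure N (Pair x -` B) \<partial>M) \<le> (\<integral>\<^sup>+x. emeasure N UNIV \<partial>M)"
        by (intro nn_integral_mono leN)
      also have "\<dots> < \<infinity>"
        using M.emeasure_finite[of UNIV] N.emeasure_finite[of UNIV]
        by (simp add: ennreal_mult_eq_top_iff less_top[symmetric])
      finally show ?thesis by simp
    qed
    have "(\<integral>\<^sup>+x. emeasure N (Pair x -` (UNIV - B)) \<partial>M)
        = (\<integral>\<^sup>+x. emeasure N UNIV - emeasure N (Pair x -` B) \<partial>M)"
      using emeasure_compl[of "Pair _ -` B" N] s[OF B] by (intro nn_integral_cong) (simp add: vimage_Diff)
    also have "\<dots> = emeasure N UNIV * emeasure M UNIV - (\<integral>\<^sup>+x. emeasure N (Pair x -` B) \<partial>M)"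
      using mN[OF B] fin leN by (subst nn_integral_diff) auto
    also have "\<dots> = emeasure M UNIV * emeasure N UNIV - (\<integral>\<^sup>+y. emeasure M ((\<lambda>x. (x, y)) -` B) \<partial>N)"
      using compl(2) by (simp add: mult.commute)
    also have "\<dots> = (\<integral>\<^sup>+y. emeasure M UNIV - emeasure M ((\<lambda>x. (x, y)) -` B) \<partial>N)"
      using mM[OF B] fin leM compl(2) by (subst nn_integral_diff) auto
    also have "\<dots> = (\<integral>\<^sup>+y. emeasure M ((\<lambda>x. (x, y)) -` (UNIV - B)) \<partial>N)"
      using emeasure_compl[of "(\<lambda>x. (x, _)) -` B" M] s[OF B] by (intro nn_integral_cong) (simp add: vimage_Diff)
    finally show ?case .
  next
    case (union B)
    then have B: "B i \<in> sets borel" for i by (auto simp: borel_eq_sigma_sets_open)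
    have "emeasure N (Pair x -` (\<Union>i. B i)) = (\<Sum>i. emeasure N (Pair x -` B i))" for x
      using union(1) s[OF B] unfolding vimage_UN
      by (intro suminf_emeasure[symmetric]) (auto simp: disjoint_family_on_def)
    moreover have "emeasure M ((\<lambda>x. (x, y)) -` (\<Union>i. B i)) = (\<Sum>i. emeasure M ((\<lambda>x. (x, y)) -` B i))" for y
      using union(1) s[OF B] unfolding vimage_UN
      by (intro suminf_emeasure[symmetric]) (auto simp: disjoint_family_on_def)
    ultimately show ?case
      using union(3) mN[OF B] mM[OF B] by (simp add: nn_integral_suminf)
  qed simp
qed

text \<open>
  For \<open>f = id\<close> this makes \<open>x \<mapsto> \<delta>\<^sub>x \<times> N\<close> a Markov kernel on the Borel sets of the product space, which
  takes the place of the product measure; for \<open>f\<close> the group operation it is the kernel of the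
  random walk.
\<close>
lemma measurable_section_kernel:
  fixes N :: "'b::topological_space measure" and f :: "'a::topological_space \<times> 'b \<Rightarrow> 'c"
  assumes N: "regular_borel_measure N" "prob_space N" and f: "f \<in> borel \<rightarrow>\<^sub>M L"
  shows "(\<lambda>x. distr N L (\<lambda>y. f (x, y))) \<in> borel \<rightarrow>\<^sub>M subprob_algebra L"
proof (rule measurable_subprob_algebra)
  interpret prob_space N by fact
  note [simp] = regular_borel_measure_sets[OF N(1)] regular_borel_measure_space[OF N(1)]
  have m: "(\<lambda>y. f (x, y)) \<in> N \<rightarrow>\<^sub>M L" for x
    using measurable_compose[OF measurable_Pair_borel(1) f] by (simp cong: measurable_cong_sets)
  show "subprob_space (distr N L (\<lambda>y. f (x, y)))" for x
    using prob_space_distr[OF m] by (rule prob_space_imp_subprob_space)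
  fix A assume A: "A \<in> sets L"
  have "f -` A \<in> sets borel" using measurable_sets[OF f A] by simp
  from measurable_emeasure_section[OF N(1) finite_measure_axioms this]
  show "(\<lambda>x. emeasure (distr N L (\<lambda>y. f (x, y))) A) \<in> borel_measurable borel"
    using A m by (simp add: emeasure_distr vimage_def)
qed simp

text \<open>
  The analogue of \<open>nn_integral_bind\<close> for integrable, possibly unbounded functions, obtained from it by
  splitting \<open>f\<close> into positive and negative parts.
\<close>
lemma has_bochner_integral_bind:
  fixes f :: "'b \<Rightarrow> real"
  assumes K: "K \<in> M \<rightarrow>\<^sub>M subprob_algebra B" and f: "f \<in> borel_measurable B"
    and int: "\<And>x. x \<in> space M \<Longrightarrow> integrable (K x) f"
    and dom: "integrable M (\<lambda>x. \<integral>y. \<bar>f y\<bar> \<partial>K x)"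
    and ne: "space M \<noteq> {}"
  shows "has_bochner_integral (M \<bind> K) f (\<integral>x. (\<integral>y. f y \<partial>K x) \<partial>M)"
proof -
  note [measurable] = K f
  have sB: "sets (M \<bind> K) = sets B" by (rule sets_bind_measurable[OF K ne])
  have pos: "integrable M (\<lambda>x. \<integral>y. h y \<partial>K x)
      \<and> has_bochner_integral (M \<bind> K) h (\<integral>x. (\<integral>y. h y \<partial>K x) \<partial>M)"
    if h: "h \<in> borel_measurable B" "\<And>y. 0 \<le> h y" "\<And>y. h y \<le> \<bar>f y\<bar>" for h
  proof -
    note [measurable] = h(1)
    have hK: "integrable (K x) h" if x: "x \<in> space M" for x
    proof (rule Bochner_Integration.integrable_bound[OF int[OF x]])
      show "h \<in> borel_measurable (K x)"
        using h(1) measurable_cong_sets[OF sets_kernel[OF K x] refl] by blast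
      show "AE y in K x. norm (h y) \<le> norm (f y)"
        using h(2,3) by (intro AE_I2) simp
    qed
    have I: "integrable M (\<lambda>x. \<integral>y. h y \<partial>K x)"
    proof (rule Bochner_Integration.integrable_bound[OF dom])
      show "(\<lambda>x. \<integral>y. h y \<partial>K x) \<in> borel_measurable M" by measurable
      have "(\<integral>y. h y \<partial>K x) \<le> (\<integral>y. \<bar>f y\<bar> \<partial>K x)" if "x \<in> space M" for x
        using h int[OF that] hK[OF that] by (intro integral_mono) auto
      then show "AE x in M. norm (\<integral>y. h y \<partial>K x) \<le> norm (\<integral>y. \<bar>f y\<bar> \<partial>K x)"
        using h(2) by (intro AE_I2) (simp add: abs_of_nonneg)
    qed
    have "(\<integral>\<^sup>+y. h y \<partial>(M \<bind> K)) = (\<integral>\<^sup>+x. \<integral>\<^sup>+y. h y \<partial>K x \<partial>M)"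
      by (rule nn_integral_bind[OF _ K]) simp
    also have "\<dots> = (\<integral>\<^sup>+x. ennreal (\<integral>y. h y \<partial>K x) \<partial>M)"
      using hK h(2) by (intro nn_integral_cong) (simp add: nn_integral_eq_integral)
    also have "\<dots> = ennreal (\<integral>x. (\<integral>y. h y \<partial>K x) \<partial>M)"
      using h(2) by (intro nn_integral_eq_integral[OF I]) simp
    finally have "(\<integral>\<^sup>+y. h y \<partial>(M \<bind> K)) = ennreal (\<integral>x. (\<integral>y. h y \<partial>K x) \<partial>M)" .
    moreover have "h \<in> borel_measurable (M \<bind> K)"
      using h(1) measurable_cong_sets[OF sB refl] by blast
    ultimately show ?thesis
      using I h(2) by (intro conjI has_bochner_integral_nn_integral) auto
  qed
  let ?p = "\<lambda>y. max 0 (f y)" and ?n = "\<lambda>y. max 0 (- f y)"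
  have p: "integrable M (\<lambda>x. \<integral>y. ?p y \<partial>K x)"
      "has_bochner_integral (M \<bind> K) ?p (\<integral>x. (\<integral>y. ?p y \<partial>K x) \<partial>M)"
    using pos[of ?p] by auto
  have n: "integrable M (\<lambda>x. \<integral>y. ?n y \<partial>K x)"
      "has_bochner_integral (M \<bind> K) ?n (\<integral>x. (\<integral>y. ?n y \<partial>K x) \<partial>M)"
    using pos[of ?n] by auto
  have fpn: "f = (\<lambda>y. ?p y - ?n y)" by auto
  have "(\<integral>y. ?p y \<partial>K x) - (\<integral>y. ?n y \<partial>K x) = (\<integral>y. f y \<partial>K x)" if "x \<in> space M" for x
  proof -
    have "(\<integral>y. ?p y - ?n y \<partial>K x) = (\<integral>y. ?p y \<partial>K x) - (\<integral>y. ?n y \<partial>K x)"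
      using int[OF that] by (intro Bochner_Integration.integral_diff) auto
    then show ?thesis using fpn by simp
  qed
  then have "(\<integral>x. (\<integral>y. ?p y \<partial>K x) - (\<integral>y. ?n y \<partial>K x) \<partial>M) = (\<integral>x. (\<integral>y. f y \<partial>K x) \<partial>M)"
    by (intro Bochner_Integration.integral_cong) auto
  then have "(\<integral>x. (\<integral>y. ?p y \<partial>K x) \<partial>M) - (\<integral>x. (\<integral>y. ?n y \<partial>K x) \<partial>M)
      = (\<integral>x. (\<integral>y. f y \<partial>K x) \<partial>M)"
    using p(1) n(1) by simp
  with has_bochner_integral_diff[OF p(2) n(2)] fpn show ?thesis by simp
qed

text \<open>
  Both iterated integrals are integrals against one measure on the Borel sets of the product space,
  reached as \<open>M \<bind> K\<close> and as \<open>N \<bind> L\<close>; the two agree by Tonelli's theorem for sets.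
\<close>
theorem fubini_regular_borel:
  fixes M :: "'a::topological_space measure" and N :: "'b::topological_space measure"
    and f :: "'a \<times> 'b \<Rightarrow> real"
  assumes M: "regular_borel_measure M" "prob_space M" and N: "regular_borel_measure N" "prob_space N"
    and f: "f \<in> borel_measurable borel"
    and int: "\<And>x. integrable N (\<lambda>y. f (x, y))" "\<And>y. integrable M (\<lambda>x. f (x, y))"
    and dom: "integrable M (\<lambda>x. \<integral>y. \<bar>f (x, y)\<bar> \<partial>N)" "integrable N (\<lambda>y. \<integral>x. \<bar>f (x, y)\<bar> \<partial>M)"
  shows "(\<integral>x. (\<integral>y. f (x, y) \<partial>N) \<partial>M) = (\<integral>y. (\<integral>x. f (x, y) \<partial>M) \<partial>N)"
proof -
  interpret M: prob_space M by fact
  interpret N: prob_space N by fact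
  note [simp] = regular_borel_measure_sets[OF N(1)] regular_borel_measure_space[OF N(1)]
    regular_borel_measure_sets[OF M(1)] regular_borel_measure_space[OF M(1)]
  note [simp] = measurable_cong_sets[OF regular_borel_measure_sets[OF N(1)] refl]
    measurable_cong_sets[OF regular_borel_measure_sets[OF M(1)] refl]
  define K where "K x = distr N borel (\<lambda>y. (x, y))" for x :: 'a
  define L where "L y = distr M borel (\<lambda>x. (x, y))" for y :: 'b
  have K: "K \<in> M \<rightarrow>\<^sub>M subprob_algebra borel"
    using measurable_section_kernel[OF N, of id borel] by (simp add: K_def[abs_def])
  have "(prod.swap :: 'b \<times> 'a \<Rightarrow> _) \<in> borel_measurable borel"
    by (intro borel_measurable_continuous_onI continuous_on_swap)
  then have L: "L \<in> N \<rightarrow>\<^sub>M subprob_algebra borel"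
    using measurable_section_kernel[OF M, of prod.swap borel] by (simp add: L_def[abs_def])
  have eq: "M \<bind> K = N \<bind> L"
  proof (rule measure_eqI)
    show "sets (M \<bind> K) = sets (N \<bind> L)"
      using sets_bind_measurable[OF K] sets_bind_measurable[OF L] by simp
    fix A assume "A \<in> sets (M \<bind> K)"
    then have A: "A \<in> sets borel" using sets_bind_measurable[OF K] by simp
    then show "emeasure (M \<bind> K) A = emeasure (N \<bind> L) A"
      using tonelli_borel_set[OF M(1) M.finite_measure_axioms N(1) N.finite_measure_axioms A]
      by (simp add: emeasure_bind[OF _ K] emeasure_bind[OF _ L] K_def L_def emeasure_distr
          measurable_Pair_borel)
  qed
  have "has_bochner_integral (M \<bind> K) f (\<integral>x. (\<integral>y. f y \<partial>K x) \<partial>M)"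
    using int(1) dom(1) f
    by (intro has_bochner_integral_bind[OF K f])
      (simp_all add: K_def integrable_distr_eq integral_distr measurable_Pair_borel)
  moreover have "has_bochner_integral (N \<bind> L) f (\<integral>x. (\<integral>y. f y \<partial>L x) \<partial>N)"
    using int(2) dom(2) f
    by (intro has_bochner_integral_bind[OF L f])
      (simp_all add: L_def integrable_distr_eq integral_distr measurable_Pair_borel)
  ultimately have "(\<integral>x. (\<integral>y. f y \<partial>K x) \<partial>M) = (\<integral>x. (\<integral>y. f y \<partial>L x) \<partial>N)"
    unfolding eq by (metis has_bochner_integral_eq)
  then show ?thesis
    using f by (simp add: K_def L_def integral_distr measurable_Pair_borel)
qed

section \<open>Common fixed points of monotone operators with drift\<close>

definition bounded_perturbations :: "('a::topological_space \<Rightarrow> real) \<Rightarrow> real \<Rightarrow> ('a \<Rightarrow> real) set" where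
  "bounded_perturbations \<phi> C = {f \<in> borel_measurable borel. \<forall>x. \<bar>f x - \<phi> x\<bar> \<le> C}"

lemma bounded_perturbations_mono:
  "f \<in> bounded_perturbations \<phi> C \<Longrightarrow> C \<le> C' \<Longrightarrow> f \<in> bounded_perturbations \<phi> C'"
  unfolding bounded_perturbations_def by (auto intro: order_trans)

lemma bounded_perturbations_measurable:
  "f \<in> bounded_perturbations \<phi> C \<Longrightarrow> f \<in> borel_measurable borel"
  by (simp add: bounded_perturbations_def)

lemma bounded_perturbations_bound:
  "f \<in> bounded_perturbations \<phi> C \<Longrightarrow> \<bar>f x - \<phi> x\<bar> \<le> C"
  by (simp add: bounded_perturbations_def)

lemma bounded_perturbations_LIMSEQ:
  assumes f: "\<And>n. f n \<in> bounded_perturbations \<phi> C" and h: "\<And>x. (\<lambda>n. f n x) \<longlonglongrightarrow> h x"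
  shows "h \<in> bounded_perturbations \<phi> C"
proof -
  have "h \<in> borel_measurable borel"
    by (rule borel_measurable_LIMSEQ_real[OF h]) (rule bounded_perturbations_measurable[OF f])
  moreover have "\<bar>h x - \<phi> x\<bar> \<le> C" for x
  proof (rule LIMSEQ_le_const2)
    show "(\<lambda>n. \<bar>f n x - \<phi> x\<bar>) \<longlonglongrightarrow> \<bar>h x - \<phi> x\<bar>" by (intro tendsto_intros h)
  qed (use bounded_perturbations_bound[OF f] in auto)
  ultimately show ?thesis by (simp add: bounded_perturbations_def)
qed

text \<open>
  What is retained of the operator \<open>f \<mapsto> P f - l\<close>: it satisfies monotone and dominated convergence on
  functions close to \<open>\<phi>\<close>, and the subtracted drift \<open>l\<close> is the right one, so that all powers stay
  within the same distance \<open>D\<close>.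
\<close>
locale drift_operator =
  fixes \<phi> :: "'a::topological_space \<Rightarrow> real" and T :: "('a \<Rightarrow> real) \<Rightarrow> ('a \<Rightarrow> real)" and D :: real
  assumes mono: "\<And>f h C x. f \<in> bounded_perturbations \<phi> C \<Longrightarrow> h \<in> bounded_perturbations \<phi> C \<Longrightarrow>
      (\<And>y. f y \<le> h y) \<Longrightarrow> T f x \<le> T h x"
    and continuous: "\<And>f h C x. (\<And>n. f n \<in> bounded_perturbations \<phi> C) \<Longrightarrow>
      (\<And>y. (\<lambda>n. f n y) \<longlonglongrightarrow> h y) \<Longrightarrow> (\<lambda>n. T (f n) x) \<longlonglongrightarrow> T h x"
    and power: "\<And>f C n. f \<in> bounded_perturbations \<phi> C \<Longrightarrow> (T ^^ n) f \<in> bounded_perturbations \<phi> (C + D)"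
begin

lemma closed: "f \<in> bounded_perturbations \<phi> C \<Longrightarrow> T f \<in> bounded_perturbations \<phi> (C + D)"
  using power[of f C 1] by simp

lemma power_mono:
  assumes "f \<in> bounded_perturbations \<phi> C" "h \<in> bounded_perturbations \<phi> C" "\<And>y. f y \<le> h y"
  shows "(T ^^ n) f x \<le> (T ^^ n) h x"
proof (induction n arbitrary: x)
  case (Suc n)
  show ?case using mono[OF power[OF assms(1)] power[OF assms(2)] Suc.IH] by simp
qed (use assms in simp)

text \<open>
  The reverse Fatou inequality. With \<open>d = 1\<close> it applies to an orbit of \<open>T\<close>, with \<open>d = 0\<close> to a sequence of
  functions each of which is subinvariant.
\<close>
lemma limsup_subinvariant:
  fixes d :: nat
  assumes f: "\<And>n. f n \<in> bounded_perturbations \<phi> C" and le: "\<And>n x. f (n + d) x \<le> T (f n) x"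
  defines "u \<equiv> \<lambda>x. INF n. SUP m\<in>{n..}. f m x"
  shows "u \<in> bounded_perturbations \<phi> C" "u x \<le> T u x"
proof -
  define s where "s n x = (SUP m\<in>{n..}. f m x)" for n x
  have bd: "\<phi> x - C \<le> f n x" "f n x \<le> \<phi> x + C" for n x
    using bounded_perturbations_bound[OF f[of n], of x] by linarith+
  have above: "bdd_above ((\<lambda>m. f m x) ` {n..})" for n x
    by (rule bdd_aboveI2[of _ _ "\<phi> x + C"]) (rule bd)
  have s_upper: "f m x \<le> s n x" if "n \<le> m" for m n x
    unfolding s_def using that by (intro cSUP_upper above) auto
  have s_least: "s n x \<le> c" if "\<And>m. n \<le> m \<Longrightarrow> f m x \<le> c" for n x c
    unfolding s_def using that by (intro cSUP_least) auto
  have sC: "s n \<in> bounded_perturbations \<phi> C" for n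
  proof -
    have "s n \<in> borel_measurable borel"
      unfolding s_def using above by (intro borel_measurable_cSUP bounded_perturbations_measurable[OF f]) auto
    moreover have "\<bar>s n x - \<phi> x\<bar> \<le> C" for x
    proof -
      have "s n x \<le> \<phi> x + C" by (rule s_least) (rule bd)
      moreover have "\<phi> x - C \<le> s n x" by (rule order_trans[OF bd(1) s_upper[OF order_refl]])
      ultimately show ?thesis by linarith
    qed
    ultimately show ?thesis by (simp add: bounded_perturbations_def)
  qed
  have below: "bdd_below (range (\<lambda>n. s n x))" for x
    by (rule bdd_belowI2[of _ "\<phi> x - C"]) (use bd s_upper order_trans in blast)
  have lim: "(\<lambda>n. s n y) \<longlonglongrightarrow> u y" for y
    unfolding u_def s_def[symmetric]
    using below by (intro LIMSEQ_decseq_INF) (auto simp: decseq_def intro!: s_least s_upper)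
  show "u \<in> bounded_perturbations \<phi> C"
    by (rule bounded_perturbations_LIMSEQ[OF sC lim])
  have "u x \<le> T (s n) x" for n
  proof -
    have "f m x \<le> T (s n) x" if m: "n + d \<le> m" for m
    proof -
      have "f m x = f ((m - d) + d) x" using m by simp
      also have "\<dots> \<le> T (f (m - d)) x" by (rule le)
      also have "\<dots> \<le> T (s n) x" using m by (intro mono[OF f sC] s_upper) simp
      finally show ?thesis .
    qed
    then have "s (n + d) x \<le> T (s n) x" by (rule s_least)
    moreover have "u x \<le> s (n + d) x"
      unfolding u_def s_def[symmetric] by (intro cINF_lower below) simp
    ultimately show ?thesis by simp
  qed
  then show "u x \<le> T u x"
    by (intro LIMSEQ_le_const[OF continuous[OF sC lim]]) auto
qed

lemma subinvariant_iterates: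
  assumes f: "f \<in> bounded_perturbations \<phi> C" and le: "\<And>x. f x \<le> T f x"
  obtains h where "h \<in> bounded_perturbations \<phi> (C + D)" "\<And>x. (\<lambda>n. (T ^^ n) f x) \<longlonglongrightarrow> h x" "T h = h"
proof -
  have step: "(T ^^ n) f x \<le> (T ^^ Suc n) f x" for n x
  proof (induction n arbitrary: x)
    case (Suc n)
    show ?case using mono[OF power[OF f, of n] power[OF f, of "Suc n"] Suc.IH, of x] by simp
  qed (use le in simp)
  have inc: "incseq (\<lambda>n. (T ^^ n) f x)" for x
    using step by (intro incseq_SucI)
  have "bdd_above (range (\<lambda>n. (T ^^ n) f x))" for x
  proof (rule bdd_aboveI2[of _ _ "\<phi> x + (C + D)"])
    show "(T ^^ n) f x \<le> \<phi> x + (C + D)" for n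
      using bounded_perturbations_bound[OF power[OF f, of n], of x] by linarith
  qed
  from LIMSEQ_incseq_SUP[OF this inc]
  have "\<exists>l. (\<lambda>n. (T ^^ n) f x) \<longlonglongrightarrow> l" for x by blast
  then obtain h where h: "\<And>x. (\<lambda>n. (T ^^ n) f x) \<longlonglongrightarrow> h x" by metis
  have "T h x = h x" for x
  proof (rule LIMSEQ_unique)
    show "(\<lambda>n. (T ^^ Suc n) f x) \<longlonglongrightarrow> T h x"
      using continuous[OF power[OF f] h] by simp
    show "(\<lambda>n. (T ^^ Suc n) f x) \<longlonglongrightarrow> h x" by (rule LIMSEQ_Suc[OF h])
  qed
  then show thesis
    using that[OF bounded_perturbations_LIMSEQ[OF power[OF f] h] h] by blast
qed

lemma commutes_with_powers:
  assumes comm: "\<And>f C. f \<in> bounded_perturbations \<phi> C \<Longrightarrow> S (T f) = T (S f)"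
    and f: "f \<in> bounded_perturbations \<phi> C"
  shows "S ((T ^^ n) f) = (T ^^ n) (S f)"
  by (induction n) (simp_all add: comm[OF power[OF f]])

end

theorem commuting_drift_operators_common_fixpoint:
  assumes T: "drift_operator \<phi> T D" and S: "drift_operator \<phi> S D'"
    and comm: "\<And>f C. f \<in> bounded_perturbations \<phi> C \<Longrightarrow> S (T f) = T (S f)"
    and \<phi>: "\<phi> \<in> borel_measurable borel"
  obtains h C where "h \<in> bounded_perturbations \<phi> C" "T h = h" "S h = h"
proof -
  interpret T: drift_operator \<phi> T D by fact
  interpret S: drift_operator \<phi> S D' by fact
  have ST: "S ((T ^^ n) f) = (T ^^ n) (S f)" if "f \<in> bounded_perturbations \<phi> C" for f C n
    using T.commutes_with_powers[of S, OF comm that] .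
  have TS: "T ((S ^^ n) f) = (S ^^ n) (T f)" if "f \<in> bounded_perturbations \<phi> C" for f C n
    using S.commutes_with_powers[of T, OF comm[symmetric] that] .
  have \<phi>0: "\<phi> \<in> bounded_perturbations \<phi> 0" using \<phi> by (simp add: bounded_perturbations_def)
  \<comment> \<open>upper limits make the function subinvariant, first for \<open>T\<close>, then for \<open>S\<close> without losing \<open>T\<close>\<close>
  define u where "u x = (INF n. SUP m\<in>{n..}. (T ^^ m) \<phi> x)" for x
  have u: "u \<in> bounded_perturbations \<phi> (0 + D)" "u x \<le> T u x" for x
    unfolding u_def using T.limsup_subinvariant[of "\<lambda>n. (T ^^ n) \<phi>" "0 + D" 1, OF T.power[OF \<phi>0]] by auto
  let ?C = "0 + D"
  define v where "v x = (INF n. SUP m\<in>{n..}. (S ^^ m) u x)" for x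
  have v: "v \<in> bounded_perturbations \<phi> (?C + D')" "v x \<le> S v x" for x
    unfolding v_def using S.limsup_subinvariant[of "\<lambda>n. (S ^^ n) u" "?C + D'" 1, OF S.power[OF u(1)]] by auto
  have Tu: "T u \<in> bounded_perturbations \<phi> (?C + D)" by (rule T.closed[OF u(1)])
  \<comment> \<open>\<open>D\<close> is not assumed nonnegative, so a common bound for \<open>u\<close> and \<open>T u\<close> is a maximum\<close>
  let ?E = "max ?C (?C + D)"
  have SuT: "(S ^^ n) u x \<le> T ((S ^^ n) u) x" for n x
    unfolding TS[OF u(1)]
    by (rule S.power_mono[of _ ?E]) (auto intro: bounded_perturbations_mono[OF u(1)] bounded_perturbations_mono[OF Tu] u(2))
  have vT: "v x \<le> T v x" for x
    unfolding v_def using T.limsup_subinvariant(2)[of "\<lambda>n. (S ^^ n) u" "?C + D'" 0, OF S.power[OF u(1)]] SuT by auto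
  let ?F = "?C + D'"
  \<comment> \<open>increasing limits turn subinvariance into invariance, first for \<open>S\<close>, then for \<open>T\<close>\<close>
  obtain w where w: "w \<in> bounded_perturbations \<phi> (?F + D')" "\<And>x. (\<lambda>n. (S ^^ n) v x) \<longlonglongrightarrow> w x" "S w = w"
    by (rule S.subinvariant_iterates[OF v]) (rule that)
  have Tv: "T v \<in> bounded_perturbations \<phi> (?F + D)" by (rule T.closed[OF v(1)])
  let ?G = "max ?F (?F + D)"
  have "(S ^^ n) v x \<le> T ((S ^^ n) v) x" for n x
    unfolding TS[OF v(1)]
    by (rule S.power_mono[of _ ?G]) (auto intro: bounded_perturbations_mono[OF v(1)] bounded_perturbations_mono[OF Tv] vT)
  then have wT: "w x \<le> T w x" for x
    using LIMSEQ_le[OF w(2) T.continuous[OF S.power[OF v(1)] w(2)]] by blast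
  obtain h where h: "h \<in> bounded_perturbations \<phi> (?F + D' + D)" "\<And>x. (\<lambda>n. (T ^^ n) w x) \<longlonglongrightarrow> h x" "T h = h"
    by (rule T.subinvariant_iterates[OF w(1) wT]) (rule that)
  have "S h x = h x" for x
  proof (rule LIMSEQ_unique)
    show "(\<lambda>n. S ((T ^^ n) w) x) \<longlonglongrightarrow> S h x"
      by (rule S.continuous[OF T.power[OF w(1)] h(2)])
    show "(\<lambda>n. S ((T ^^ n) w) x) \<longlonglongrightarrow> h x"
      using h(2) by (simp add: ST[OF w(1)] w(3))
  qed
  then show thesis using that[OF h(1,3)] by blast
qed

section \<open>Averages of a quasimorphism\<close>

text \<open>
  Fekete's argument in two-sided form: comparing \<open>a (m * n)\<close> with \<open>n * a m\<close> and with \<open>m * a n\<close> shows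
  that \<open>a m / m\<close> and \<open>a n / n\<close> differ by at most \<open>D / m + D / n\<close>.
\<close>
lemma quasi_additive_sequence:
  fixes a :: "nat \<Rightarrow> real"
  assumes a: "\<And>m n. \<bar>a (m + n) - a m - a n\<bar> \<le> D"
  obtains l where "(\<lambda>n. a n / real n) \<longlonglongrightarrow> l" "\<And>n. \<bar>a n - real n * l\<bar> \<le> D"
proof -
  have D: "0 \<le> D" using a[of 0 0] by linarith
  have mult: "\<bar>a (Suc k * m) - real (Suc k) * a m\<bar> \<le> real k * D" for k m
  proof (induction k)
    case (Suc k)
    have "a (Suc (Suc k) * m) - real (Suc (Suc k)) * a m
        = (a (Suc k * m) - real (Suc k) * a m) + (a (m + Suc k * m) - a m - a (Suc k * m))"
      by (simp add: algebra_simps)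
    with Suc.IH a[of m "Suc k * m"] show ?case by (simp add: algebra_simps)
  qed simp
  have close: "\<bar>a m / real m - a n / real n\<bar> \<le> D / real m + D / real n" if mn: "0 < m" "0 < n" for m n
  proof -
    have q: "\<bar>a (k * m) - real k * a m\<bar> \<le> real k * D" if k: "0 < k" for k m
    proof -
      obtain j where j: "k = Suc j" using k by (cases k) auto
      have "real j * D \<le> real k * D" using D j by (intro mult_right_mono) auto
      with mult[of j m] show ?thesis unfolding j by linarith
    qed
    have "\<bar>real n * a m - real m * a n\<bar> \<le> real n * D + real m * D"
      using q[OF mn(2), of m] q[OF mn(1), of n] by (simp add: mult.commute)
    moreover have "a m / real m - a n / real n = (real n * a m - real m * a n) / (real m * real n)"
      "D / real m + D / real n = (real n * D + real m * D) / (real m * real n)"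
      using mn by (simp_all add: field_simps)
    ultimately show ?thesis using mn by (simp add: abs_mult divide_right_mono)
  qed
  have "Cauchy (\<lambda>n. a n / real n)"
  proof (rule metric_CauchyI)
    fix e :: real assume e: "0 < e"
    obtain N :: nat where N: "2 * D / e < real N" using reals_Archimedean2 by blast
    have "\<bar>a m / real m - a n / real n\<bar> < e" if mn: "Suc N \<le> m" "Suc N \<le> n" for m n
    proof -
      have "D / real k \<le> D / real (Suc N)" if "Suc N \<le> k" for k
        using that D by (intro divide_left_mono) auto
      from this[OF mn(1)] this[OF mn(2)] close[of m n] mn
      have "\<bar>a m / real m - a n / real n\<bar> \<le> 2 * D / real (Suc N)" by simp
      also have "\<dots> < e"
      proof -
        have "2 * D < real N * e" using N e by (simp add: field_simps)
        also have "\<dots> \<le> real (Suc N) * e" using e by simp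
        finally show ?thesis by (simp add: field_simps)
      qed
      finally show ?thesis .
    qed
    then show "\<exists>M. \<forall>m\<ge>M. \<forall>n\<ge>M. dist (a m / real m) (a n / real n) < e"
      by (auto simp: dist_real_def intro!: exI[of _ "Suc N"])
  qed
  then obtain l where l: "(\<lambda>n. a n / real n) \<longlonglongrightarrow> l"
    using Cauchy_convergent convergentD by blast
  have "\<bar>a m - real m * l\<bar> \<le> D" for m
  proof (cases "m = 0")
    case True
    then show ?thesis using a[of 0 0] by simp
  next
    case False
    have "\<bar>a m / real m - l\<bar> \<le> D / real m"
    proof (rule LIMSEQ_le)
      show "(\<lambda>n. \<bar>a m / real m - a n / real n\<bar>) \<longlonglongrightarrow> \<bar>a m / real m - l\<bar>" by (intro tendsto_intros l)
      have "(\<lambda>n. D / real m + D * inverse (real n)) \<longlonglongrightarrow> D / real m + D * 0"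
        by (intro tendsto_intros lim_inverse_n)
      then show "(\<lambda>n. D / real m + D / real n) \<longlonglongrightarrow> D / real m" by (simp add: divide_inverse)
      show "\<exists>N. \<forall>n\<ge>N. \<bar>a m / real m - a n / real n\<bar> \<le> D / real m + D / real n"
        using close False by (intro exI[of _ 1]) auto
    qed
    then have "real m * \<bar>a m / real m - l\<bar> \<le> real m * (D / real m)" by (intro mult_left_mono) auto
    moreover have "real m * \<bar>a m / real m - l\<bar> = \<bar>real m * (a m / real m - l)\<bar>" by (simp add: abs_mult)
    ultimately show ?thesis using False by (simp add: algebra_simps)
  qed
  with l show thesis by (rule that)
qed

lemma (in prob_space) abs_integral_diff_le:
  assumes "integrable M f" "integrable M h" "\<And>x. \<bar>f x - h x - c\<bar> \<le> d"
  shows "\<bar>(\<integral>x. f x \<partial>M) - (\<integral>x. h x \<partial>M) - c\<bar> \<le> (d :: real)"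
proof -
  have "(\<integral>x. f x - h x - c \<partial>M) = (\<integral>x. f x \<partial>M) - (\<integral>x. h x \<partial>M) - c"
    using assms by (simp add: prob_space)
  moreover have "\<bar>\<integral>x. f x - h x - c \<partial>M\<bar> \<le> (\<integral>x. \<bar>f x - h x - c\<bar> \<partial>M)" by (rule integral_abs_bound)
  moreover have "(\<integral>x. \<bar>f x - h x - c\<bar> \<partial>M) \<le> (\<integral>x. d \<partial>M)"
    using assms by (intro integral_mono) auto
  ultimately show ?thesis by (simp add: prob_space)
qed

text \<open>
  The multiplication is a parameter so that the locale covers both the group operation and the
  opposite one, that is, right and left averages.
\<close>
locale integrable_quasimorphism = prob_space \<mu>
  for mul :: "'a::topological_space \<Rightarrow> 'a \<Rightarrow> 'a" and e :: 'a and \<mu> :: "'a measure"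
    and \<phi> :: "'a \<Rightarrow> real" and D :: real +
  assumes mul_continuous: "continuous_on UNIV (\<lambda>p. mul (fst p) (snd p))"
    and mul_assoc: "\<And>g h k. mul (mul g h) k = mul g (mul h k)"
    and mul_unit: "\<And>g. mul g e = g"
    and regular: "regular_borel_measure \<mu>"
    and measurable: "\<phi> \<in> borel_measurable borel"
    and integrable: "integrable \<mu> \<phi>"
    and defect: "\<And>g h. \<bar>\<phi> (mul g h) - \<phi> g - \<phi> h\<bar> \<le> D"
begin

abbreviation "E \<equiv> bounded_perturbations \<phi>"

definition average :: "('a \<Rightarrow> real) \<Rightarrow> 'a \<Rightarrow> real" where
  "average f g = (\<integral>k. f (mul g k) \<partial>\<mu>)"

lemma measurable_mu: "borel_measurable \<mu> = borel_measurable borel"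
  using measurable_cong_sets[OF regular_borel_measure_sets[OF regular] refl] .

lemma measurable_mul: "(\<lambda>p. mul (fst p) (snd p)) \<in> borel_measurable borel"
  by (rule borel_measurable_continuous_onI[OF mul_continuous])

lemma measurable_mul_left: "mul g \<in> borel_measurable borel"
  using measurable_compose[OF measurable_Pair_borel(1)[of g] measurable_mul] by simp

lemma phi_mem: "\<phi> \<in> E 0"
  using measurable by (simp add: bounded_perturbations_def)

lemma translate_bound:
  assumes "f \<in> E C" shows "\<bar>f (mul g k)\<bar> \<le> \<bar>\<phi> k\<bar> + (\<bar>\<phi> g\<bar> + C + D)"
  using bounded_perturbations_bound[OF assms, of "mul g k"] defect[of g k] by linarith

lemma integrable_translate:
  assumes f: "f \<in> E C" shows "integrable \<mu> (\<lambda>k. f (mul g k))"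
proof (rule Bochner_Integration.integrable_bound)
  show "integrable \<mu> (\<lambda>k. \<bar>\<phi> k\<bar> + (\<bar>\<phi> g\<bar> + C + D))" using integrable by simp
  show "(\<lambda>k. f (mul g k)) \<in> borel_measurable \<mu>"
    unfolding measurable_mu
    using measurable_compose[OF measurable_mul_left bounded_perturbations_measurable[OF f]] .
  show "AE k in \<mu>. norm (f (mul g k)) \<le> norm (\<bar>\<phi> k\<bar> + (\<bar>\<phi> g\<bar> + C + D))"
    using translate_bound[OF f, of g] by (intro AE_I2) (auto intro: order_trans[OF _ abs_ge_self])
qed

lemma measurable_average:
  assumes f: "f \<in> borel_measurable borel" shows "average f \<in> borel_measurable borel"
proof -
  let ?K = "\<lambda>g. distr \<mu> borel (\<lambda>k. mul g k)"
  have K: "?K \<in> borel \<rightarrow>\<^sub>M subprob_algebra borel"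
    using measurable_section_kernel[OF regular prob_space_axioms measurable_mul] by simp
  have "average f = (\<lambda>g. \<integral>k. f k \<partial>?K g)"
    using f measurable_mul_left by (intro ext) (simp add: average_def integral_distr measurable_mu)
  then show ?thesis
    using measurable_compose[OF K integral_measurable_subprob_algebra[OF f]] by simp
qed

lemma average_mem:
  assumes f: "f \<in> E C" shows "average f \<in> E (C + D + (\<integral>k. \<bar>\<phi> k\<bar> \<partial>\<mu>))"
proof -
  have "\<bar>average f g - \<phi> g\<bar> \<le> C + D + (\<integral>k. \<bar>\<phi> k\<bar> \<partial>\<mu>)" for g
  proof -
    have "\<bar>f (mul g k) - \<phi> k - \<phi> g\<bar> \<le> C + D" for k
      using bounded_perturbations_bound[OF f, of "mul g k"] defect[of g k] by linarith
    from abs_integral_diff_le[OF integrable_translate[OF f] integrable this]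
    have "\<bar>average f g - (\<integral>k. \<phi> k \<partial>\<mu>) - \<phi> g\<bar> \<le> C + D" by (simp add: average_def)
    moreover have "\<bar>\<integral>k. \<phi> k \<partial>\<mu>\<bar> \<le> (\<integral>k. \<bar>\<phi> k\<bar> \<partial>\<mu>)" by (rule integral_abs_bound)
    ultimately show ?thesis by linarith
  qed
  then show ?thesis
    using measurable_average[OF bounded_perturbations_measurable[OF f]]
    by (simp add: bounded_perturbations_def)
qed

lemma average_abs:
  assumes f: "f \<in> E C"
  shows "average (\<lambda>x. \<bar>f x\<bar>) \<in> borel_measurable borel"
    and "\<bar>average (\<lambda>x. \<bar>f x\<bar>) g\<bar> \<le> \<bar>\<phi> g\<bar> + ((\<integral>k. \<bar>\<phi> k\<bar> \<partial>\<mu>) + C + D)"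
proof -
  show "average (\<lambda>x. \<bar>f x\<bar>) \<in> borel_measurable borel"
    using bounded_perturbations_measurable[OF f] by (intro measurable_average) simp
  have "average (\<lambda>x. \<bar>f x\<bar>) g \<le> (\<integral>k. \<bar>\<phi> k\<bar> + (\<bar>\<phi> g\<bar> + C + D) \<partial>\<mu>)"
    unfolding average_def using integrable
    by (intro integral_mono integrable_abs integrable_translate[OF f] translate_bound[OF f]) simp
  also have "\<dots> = \<bar>\<phi> g\<bar> + ((\<integral>k. \<bar>\<phi> k\<bar> \<partial>\<mu>) + C + D)"
    using integrable by (simp add: prob_space)
  finally show "\<bar>average (\<lambda>x. \<bar>f x\<bar>) g\<bar> \<le> \<bar>\<phi> g\<bar> + ((\<integral>k. \<bar>\<phi> k\<bar> \<partial>\<mu>) + C + D)"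
    by (simp add: average_def)
qed

lemma average_diff_const:
  assumes "f \<in> E C" shows "average (\<lambda>g. f g - c) = (\<lambda>g. average f g - c)"
  using integrable_translate[OF assms] by (simp add: average_def prob_space fun_eq_iff)

lemma average_power_mem:
  assumes "f \<in> E C" shows "\<exists>C'. (average ^^ n) f \<in> E C'"
proof (induction n)
  case 0
  show ?case using assms by auto
next
  case (Suc n)
  then show ?case using average_mem by auto
qed

lemma average_power_contraction:
  assumes f: "f \<in> E C" and h: "h \<in> E C'" and fh: "\<And>x. \<bar>f x - h x - c\<bar> \<le> d"
  shows "\<bar>(average ^^ n) f x - (average ^^ n) h x - c\<bar> \<le> d"
proof (induction n arbitrary: x)
  case (Suc n)
  obtain B B' where "(average ^^ n) f \<in> E B" "(average ^^ n) h \<in> E B'"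
    using average_power_mem[OF f] average_power_mem[OF h] by blast
  from abs_integral_diff_le[OF this[THEN integrable_translate] Suc.IH]
  show ?case by (simp add: average_def)
qed (use fh in simp)

text \<open>
  The defect bound does not deteriorate under averaging, because each average acts on the right
  factor only. This uniformity in \<open>n\<close> is what makes the powers of the averages comparable with \<open>\<phi>\<close>.
\<close>
lemma average_power_defect:
  "\<bar>(average ^^ n) \<phi> (mul g k) - (average ^^ n) \<phi> k - \<phi> g\<bar> \<le> D"
proof (induction n arbitrary: k)
  case 0
  show ?case using defect[of g k] by simp
next
  case (Suc n)
  define F where "F = (average ^^ n) \<phi>"
  obtain B where "F \<in> E B" using average_power_mem[OF phi_mem] F_def by blast
  note i = integrable_translate[OF this]
  have "\<bar>(\<integral>j. F (mul (mul g k) j) \<partial>\<mu>) - (\<integral>j. F (mul k j) \<partial>\<mu>) - \<phi> g\<bar> \<le> D"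
    using abs_integral_diff_le[OF i[of "mul g k"] i[of k], of "\<phi> g" D] Suc.IH
    by (simp add: mul_assoc F_def)
  then show ?case by (simp add: average_def[of F] F_def[symmetric])
qed

text \<open>The integral of \<open>\<phi>\<close> against the \<open>n\<close>-th convolution power, see \<open>integral_convolution_power\<close> below.\<close>
definition mean :: "nat \<Rightarrow> real" where "mean n = (average ^^ n) \<phi> e"

lemma average_power_phi: "\<bar>(average ^^ n) \<phi> g - \<phi> g - mean n\<bar> \<le> D"
  using average_power_defect[of n g e] by (simp add: mul_unit mean_def algebra_simps)

lemma mean_quasi_additive: "\<bar>mean (m + n) - mean m - mean n\<bar> \<le> D"
proof -
  obtain C where "(average ^^ n) \<phi> \<in> E C" using average_power_mem[OF phi_mem] by blast
  from average_power_contraction[OF this phi_mem average_power_phi, of m e]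
  show ?thesis by (simp add: mean_def funpow_add)
qed

lemma drift_operator:
  assumes l: "\<And>n. \<bar>mean n - real n * l\<bar> \<le> D"
  shows "drift_operator \<phi> (\<lambda>f g. average f g - l) (D + D)"
proof
  fix f h :: "'a \<Rightarrow> real" and C x
  assume f: "f \<in> E C" and h: "h \<in> E C" and fh: "\<And>y. f y \<le> h y"
  show "average f x - l \<le> average h x - l"
    using integral_mono[OF integrable_translate[OF f] integrable_translate[OF h] fh] by (simp add: average_def)
next
  fix f :: "nat \<Rightarrow> 'a \<Rightarrow> real" and h C x
  assume f: "\<And>n. f n \<in> E C" and h: "\<And>y. (\<lambda>n. f n y) \<longlonglongrightarrow> h y"
  have "(\<lambda>n. \<integral>k. f n (mul x k) \<partial>\<mu>) \<longlonglongrightarrow> (\<integral>k. h (mul x k) \<partial>\<mu>)"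
  proof (rule integral_dominated_convergence)
    show "(\<lambda>k. h (mul x k)) \<in> borel_measurable \<mu>"
      using integrable_translate[OF bounded_perturbations_LIMSEQ[OF f h]] by blast
    show "(\<lambda>k. f n (mul x k)) \<in> borel_measurable \<mu>" for n using integrable_translate[OF f] by blast
    show "integrable \<mu> (\<lambda>k. \<bar>\<phi> k\<bar> + (\<bar>\<phi> x\<bar> + C + D))" using integrable by simp
    show "AE k in \<mu>. (\<lambda>n. f n (mul x k)) \<longlonglongrightarrow> h (mul x k)" using h by simp
    show "AE k in \<mu>. norm (f n (mul x k)) \<le> \<bar>\<phi> k\<bar> + (\<bar>\<phi> x\<bar> + C + D)" for n
      using translate_bound[OF f] by simp
  qed
  then show "(\<lambda>n. average (f n) x - l) \<longlonglongrightarrow> average h x - l"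
    unfolding average_def by (intro tendsto_intros)
next
  fix f C n assume f: "f \<in> E C"
  have eq: "((\<lambda>f g. average f g - l) ^^ n) f = (\<lambda>g. (average ^^ n) f g - real n * l)"
  proof (induction n)
    case (Suc n)
    obtain B where "(average ^^ n) f \<in> E B" using average_power_mem[OF f] by blast
    from average_diff_const[OF this, of "real n * l"] Suc.IH
    show ?case by (simp add: algebra_simps)
  qed simp
  have "\<bar>(average ^^ n) f g - real n * l - \<phi> g\<bar> \<le> C + (D + D)" for g
  proof -
    have "\<bar>f x - \<phi> x - 0\<bar> \<le> C" for x using bounded_perturbations_bound[OF f] by simp
    from average_power_contraction[OF f phi_mem this, of n g] average_power_phi[of n g] l[of n]
    show ?thesis by linarith
  qed
  moreover have "(average ^^ n) f \<in> borel_measurable borel"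
    using average_power_mem[OF f] bounded_perturbations_measurable by blast
  ultimately show "((\<lambda>f g. average f g - l) ^^ n) f \<in> E (C + (D + D))"
    unfolding eq by (simp add: bounded_perturbations_def)
qed

end

section \<open>Convolution powers and two-sided averages on a group\<close>

lemma group_convolution_eq_bind:
  fixes M N :: "'a::topological_group_add measure"
  assumes M: "sets M = sets borel" and N: "prob_space N" "regular_borel_measure N"
  shows "(\<lambda>g. distr N borel (\<lambda>h. g + h)) \<in> M \<rightarrow>\<^sub>M subprob_algebra borel"
    and "group_convolution M N = M \<bind> (\<lambda>g. distr N borel (\<lambda>h. g + h))"
proof -
  let ?K = "\<lambda>g. distr N borel (\<lambda>h. g + h)"
  have cont: "continuous_on UNIV (\<lambda>p :: 'a \<times> 'a. fst p + snd p)"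
    unfolding continuous_on_def by (intro ballI tendsto_intros)
  have "?K \<in> borel \<rightarrow>\<^sub>M subprob_algebra borel"
    using measurable_section_kernel[OF N(2,1) borel_measurable_continuous_onI[OF cont]] by simp
  then show K: "?K \<in> M \<rightarrow>\<^sub>M subprob_algebra borel"
    using measurable_cong_sets[OF M refl] by blast
  have ne: "space M \<noteq> {}" using sets_eq_imp_space_eq[OF M] by simp
  have "(\<lambda>h. g + h) \<in> N \<rightarrow>\<^sub>M borel" for g
    using measurable_compose[OF measurable_Pair_borel(1)[of g] borel_measurable_continuous_onI[OF cont]]
      measurable_cong_sets[OF regular_borel_measure_sets[OF N(2)] refl] by auto
  then show "group_convolution M N = M \<bind> ?K"
    using emeasure_group_convolution[OF M N] regular_borel_measure_space[OF N(2)]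
    by (intro measure_eqI)
      (simp_all add: sets_bind_measurable[OF K ne] emeasure_bind[OF ne K] emeasure_distr vimage_def)
qed

text \<open>
  Induction on \<open>n\<close>: the last increment is integrated out first, which replaces \<open>f\<close> by its right average.
  For this the integrability of \<open>\<phi>\<close> has to be carried along, as \<open>\<bar>\<phi>\<bar>\<close> dominates
  the averages up to a constant.
\<close>
lemma integral_convolution_power:
  fixes \<mu> :: "'a::topological_group_add measure"
  assumes R: "integrable_quasimorphism (+) 0 \<mu> \<phi> D"
  shows "sets (convolution_power \<mu> n) = sets borel" "prob_space (convolution_power \<mu> n)"
    "f \<in> bounded_perturbations \<phi> C \<Longrightarrow> has_bochner_integral (convolution_power \<mu> n) f
      ((integrable_quasimorphism.average (+) \<mu> ^^ n) f 0)"
proof (induction n arbitrary: f C)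
  case 0
  {
    case 1
    show ?case by simp
  next
    case 2
    show ?case by (simp add: prob_space_return)
  next
    case 3
    note [measurable] = bounded_perturbations_measurable[OF 3]
    have "prob_space (return borel (0 :: 'a))" by (simp add: prob_space_return)
    then have "integrable (return borel 0) f"
      by (intro finite_measure.integrable_const_bound[of _ _ "\<bar>f 0\<bar>"] prob_space.finite_measure)
        (auto simp: AE_return)
    then show ?case by (simp add: has_bochner_integral_iff integral_return)
  }
next
  case (Suc n)
  interpret R: integrable_quasimorphism "(+)" 0 \<mu> \<phi> D by fact
  let ?M = "convolution_power \<mu> n" and ?K = "\<lambda>g. distr \<mu> borel (\<lambda>h. g + h)"
  interpret M: prob_space ?M by (rule Suc.IH(2))
  have m: "(\<lambda>h. g + h) \<in> borel_measurable \<mu>" for g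
    unfolding R.measurable_mu by (rule R.measurable_mul_left)
  have mM: "borel_measurable ?M = borel_measurable borel"
    by (rule measurable_cong_sets[OF Suc.IH(1) refl])
  have spM: "space ?M = UNIV" using sets_eq_imp_space_eq[OF Suc.IH(1)] by simp
  note K = group_convolution_eq_bind[OF Suc.IH(1) R.prob_space_axioms R.regular]
  {
    case 1
    show ?case by simp
  next
    case 2
    have "emeasure (group_convolution ?M \<mu>) UNIV = 1"
      using emeasure_group_convolution[OF Suc.IH(1) R.prob_space_axioms R.regular, of UNIV]
        R.emeasure_space_1 M.emeasure_space_1 regular_borel_measure_space[OF R.regular] by (simp add: spM)
    then show ?case by (intro prob_spaceI) simp
  next
    case (3 f C)
    note f = 3
    note fm = bounded_perturbations_measurable[OF f]
    have "integrable ?M \<phi>"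
      using Suc.IH(3)[OF R.phi_mem] by (simp add: has_bochner_integral_iff)
    then have "integrable ?M (\<lambda>g. \<bar>\<phi> g\<bar> + ((\<integral>k. \<bar>\<phi> k\<bar> \<partial>\<mu>) + C + D))" by simp
    then have "integrable ?M (R.average (\<lambda>x. \<bar>f x\<bar>))"
    proof (rule Bochner_Integration.integrable_bound)
      show "R.average (\<lambda>x. \<bar>f x\<bar>) \<in> borel_measurable ?M" unfolding mM by (rule R.average_abs[OF f])
      show "AE g in ?M. norm (R.average (\<lambda>x. \<bar>f x\<bar>) g) \<le> norm (\<bar>\<phi> g\<bar> + ((\<integral>k. \<bar>\<phi> k\<bar> \<partial>\<mu>) + C + D))"
        using R.average_abs(2)[OF f] by (intro AE_I2) (auto intro: order_trans[OF _ abs_ge_self])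
    qed
    then have "has_bochner_integral (?M \<bind> ?K) f (\<integral>g. (\<integral>y. f y \<partial>?K g) \<partial>?M)"
      using fm m R.integrable_translate[OF f]
      by (intro has_bochner_integral_bind[OF K(1) fm])
        (simp_all add: spM integrable_distr_eq integral_distr R.average_def[abs_def])
    moreover have "(\<integral>g. (\<integral>y. f y \<partial>?K g) \<partial>?M) = (\<integral>g. R.average f g \<partial>?M)"
      using fm m by (simp add: integral_distr R.average_def)
    moreover have "\<dots> = (R.average ^^ Suc n) f 0"
      using has_bochner_integral_integral_eq[OF Suc.IH(3)[OF R.average_mem[OF f]]]
      by (simp add: funpow_swap1)
    ultimately show ?case by (simp add: K(2))
  }
qed

locale two_sided_averages =
  R: integrable_quasimorphism "(+)" 0 \<mu> \<phi> D + L: integrable_quasimorphism "\<lambda>g k. k + g" 0 \<mu> \<phi> D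
  for \<mu> :: "'a::topological_group_add measure" and \<phi> :: "'a \<Rightarrow> real" and D :: real
begin

text \<open>
  Both sides average \<open>f (h + g + k)\<close> over \<open>h\<close> and \<open>k\<close>, in different orders.
\<close>
lemma averages_commute:
  assumes f: "f \<in> bounded_perturbations \<phi> C"
  shows "R.average (L.average f) = L.average (R.average f)"
proof
  fix g
  let ?F = "\<lambda>p. f (fst p + g + snd p)"
  have c: "continuous_on UNIV (\<lambda>p :: 'a \<times> 'a. fst p + g + snd p)"
    unfolding continuous_on_def by (intro ballI tendsto_intros)
  have F: "?F \<in> borel_measurable borel"
    by (rule measurable_compose[OF borel_measurable_continuous_onI[OF c]
          bounded_perturbations_measurable[OF f]])
  have dR: "integrable \<mu> (\<lambda>h. R.average (\<lambda>x. \<bar>f x\<bar>) (h + g))"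
  proof (rule Bochner_Integration.integrable_bound)
    show "integrable \<mu> (\<lambda>h. \<bar>\<phi> (h + g)\<bar> + ((\<integral>k. \<bar>\<phi> k\<bar> \<partial>\<mu>) + C + D))"
      using L.integrable_translate[OF L.phi_mem, of g] by simp
    show "(\<lambda>h. R.average (\<lambda>x. \<bar>f x\<bar>) (h + g)) \<in> borel_measurable \<mu>"
      unfolding R.measurable_mu
      by (rule measurable_compose[OF L.measurable_mul_left R.average_abs(1)[OF f]])
    show "AE h in \<mu>. norm (R.average (\<lambda>x. \<bar>f x\<bar>) (h + g))
        \<le> norm (\<bar>\<phi> (h + g)\<bar> + ((\<integral>k. \<bar>\<phi> k\<bar> \<partial>\<mu>) + C + D))"
      using R.average_abs(2)[OF f] by (intro AE_I2) (auto intro: order_trans[OF _ abs_ge_self])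
  qed
  have dL: "integrable \<mu> (\<lambda>k. L.average (\<lambda>x. \<bar>f x\<bar>) (g + k))"
  proof (rule Bochner_Integration.integrable_bound)
    show "integrable \<mu> (\<lambda>k. \<bar>\<phi> (g + k)\<bar> + ((\<integral>k. \<bar>\<phi> k\<bar> \<partial>\<mu>) + C + D))"
      using R.integrable_translate[OF R.phi_mem, of g] by simp
    show "(\<lambda>k. L.average (\<lambda>x. \<bar>f x\<bar>) (g + k)) \<in> borel_measurable \<mu>"
      unfolding R.measurable_mu
      by (rule measurable_compose[OF R.measurable_mul_left L.average_abs(1)[OF f]])
    show "AE k in \<mu>. norm (L.average (\<lambda>x. \<bar>f x\<bar>) (g + k))
        \<le> norm (\<bar>\<phi> (g + k)\<bar> + ((\<integral>k. \<bar>\<phi> k\<bar> \<partial>\<mu>) + C + D))"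
      using L.average_abs(2)[OF f] by (intro AE_I2) (auto intro: order_trans[OF _ abs_ge_self])
  qed
  have "(\<integral>h. (\<integral>k. ?F (h, k) \<partial>\<mu>) \<partial>\<mu>) = (\<integral>k. (\<integral>h. ?F (h, k) \<partial>\<mu>) \<partial>\<mu>)"
  proof (rule fubini_regular_borel[OF R.regular R.prob_space_axioms R.regular R.prob_space_axioms F])
    show "integrable \<mu> (\<lambda>k. ?F (h, k))" for h
      using R.integrable_translate[OF f, of "h + g"] by simp
    show "integrable \<mu> (\<lambda>h. ?F (h, k))" for k
      using L.integrable_translate[OF f, of "g + k"] by (simp add: add.assoc)
    show "integrable \<mu> (\<lambda>h. \<integral>k. \<bar>?F (h, k)\<bar> \<partial>\<mu>)"
      using dR by (simp add: R.average_def)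
    show "integrable \<mu> (\<lambda>k. \<integral>h. \<bar>?F (h, k)\<bar> \<partial>\<mu>)"
      using dL by (simp add: L.average_def add.assoc)
  qed
  then show "R.average (L.average f) g = L.average (R.average f) g"
    by (simp add: R.average_def L.average_def add.assoc)
qed

lemma average_commutes_with_powers:
  assumes f: "f \<in> bounded_perturbations \<phi> C"
  shows "L.average ((R.average ^^ n) f) = (R.average ^^ n) (L.average f)"
proof (induction n)
  case (Suc n)
  obtain B where "(R.average ^^ n) f \<in> bounded_perturbations \<phi> B"
    using R.average_power_mem[OF f] by blast
  from averages_commute[OF this] Suc.IH show ?case by simp
qed simp

text \<open>
  A product of \<open>n\<close> independent factors has the same law whether it is built up from the left or from
  the right; hence left and right averages have the same drift.
\<close>
lemma average_powers_agree_at_0: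
  assumes "f \<in> bounded_perturbations \<phi> C"
  shows "(L.average ^^ n) f 0 = (R.average ^^ n) f 0"
  using assms
proof (induction n arbitrary: f C)
  case (Suc n)
  have "(L.average ^^ Suc n) f 0 = (L.average ^^ n) (L.average f) 0" by (simp add: funpow_swap1)
  also have "\<dots> = (R.average ^^ n) (L.average f) 0" by (rule Suc.IH[OF L.average_mem[OF Suc.prems]])
  also have "\<dots> = L.average ((R.average ^^ n) f) 0"
    by (simp add: average_commutes_with_powers[OF Suc.prems])
  also have "\<dots> = (R.average ^^ Suc n) f 0" by (simp add: L.average_def R.average_def)
  finally show ?case .
qed simp

lemma exists_biharmonic:
  assumes l: "\<And>n. \<bar>R.mean n - real n * l\<bar> \<le> D"
  obtains h C where "h \<in> bounded_perturbations \<phi> C"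
    "\<And>g. R.average h g = h g + l" "\<And>g. L.average h g = h g + l"
proof -
  let ?T = "\<lambda>f g. R.average f g - l" and ?S = "\<lambda>f g. L.average f g - l"
  have "L.mean n = R.mean n" for n
    unfolding L.mean_def R.mean_def by (rule average_powers_agree_at_0[OF R.phi_mem])
  with l have S: "drift_operator \<phi> ?S (D + D)" by (intro L.drift_operator) simp
  have T: "drift_operator \<phi> ?T (D + D)" by (rule R.drift_operator[OF l])
  have "?S (?T f) = ?T (?S f)" if f: "f \<in> bounded_perturbations \<phi> C" for f C
    by (simp add: L.average_diff_const[OF R.average_mem[OF f]]
        R.average_diff_const[OF L.average_mem[OF f]] averages_commute[OF f])
  then obtain h C where h: "h \<in> bounded_perturbations \<phi> C" "?T h = h" "?S h = h"
    by (rule commuting_drift_operators_common_fixpoint[OF T S _ R.measurable])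
  have "R.average h g = h g + l" "L.average h g = h g + l" for g
    using fun_cong[OF h(2), of g] fun_cong[OF h(3), of g] by linarith+
  then show thesis by (rule that[OF h(1)])
qed

lemma distortion_eq:
  assumes "(\<lambda>n. R.mean n / real n) \<longlonglongrightarrow> l"
  shows "distortion \<mu> \<phi> = l"
proof -
  have "(\<integral>g. \<phi> g \<partial>convolution_power \<mu> n) = R.mean n" for n
    using has_bochner_integral_integral_eq[OF
        integral_convolution_power(3)[OF R.integrable_quasimorphism_axioms R.phi_mem]]
    by (simp add: R.mean_def)
  with assms show ?thesis unfolding distortion_def by (intro limI) simp
qed

end

section \<open>Existence of quasi-biharmonic representatives\<close>

theorem proposition2p2:
  fixes \<mu> :: "'a::topological_group_add measure" and \<phi> :: "'a \<Rightarrow> real"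
  assumes "continuum_hypothesis"
    and "prob_space \<mu>" and "regular_borel_measure \<mu>"
    and "\<phi> \<in> borel_measurable borel" and "quasimorphism \<phi>" and "integrable \<mu> \<phi>"
  shows "\<exists>\<psi> :: 'a \<Rightarrow> real.
    quasimorphism \<psi> \<and>
    universally_measurable_map borel borel \<psi> \<and>
    equivalent_qm \<psi> \<phi> \<and>
    integrable (completion \<mu>) \<psi> \<and>
    (\<forall>g. has_bochner_integral (completion \<mu>) (\<lambda>k. \<psi> (g + k)) (\<psi> g + distortion \<mu> \<phi>) \<and>
         has_bochner_integral (completion \<mu>) (\<lambda>k. \<psi> (k + g)) (\<psi> g + distortion \<mu> \<phi>))"
proof -
  from assms(5) obtain D where D: "\<And>g h. \<bar>\<phi> (g + h) - \<phi> g - \<phi> h\<bar> \<le> D"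
    unfolding quasimorphism_def bdd_above_def by auto
  have "continuous_on UNIV (\<lambda>p :: 'a \<times> 'a. fst p + snd p)"
    "continuous_on UNIV (\<lambda>p :: 'a \<times> 'a. snd p + fst p)"
    unfolding continuous_on_def by (intro ballI tendsto_intros)+
  moreover have "\<bar>\<phi> (h + g) - \<phi> g - \<phi> h\<bar> \<le> D" for g h
    using D[of h g] by (simp add: algebra_simps)
  ultimately have "integrable_quasimorphism (+) 0 \<mu> \<phi> D"
    "integrable_quasimorphism (\<lambda>g k. k + g) 0 \<mu> \<phi> D"
    using assms D
    by (simp_all add: integrable_quasimorphism_def integrable_quasimorphism_axioms_def add.assoc)
  then interpret two_sided_averages \<mu> \<phi> D by (rule two_sided_averages.intro)
  obtain l where l: "(\<lambda>n. R.mean n / real n) \<longlonglongrightarrow> l" "\<And>n. \<bar>R.mean n - real n * l\<bar> \<le> D"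
    by (rule quasi_additive_sequence[of R.mean, OF R.mean_quasi_additive]) (rule that)
  obtain \<psi> C where \<psi>: "\<psi> \<in> bounded_perturbations \<phi> C"
      "\<And>g. R.average \<psi> g = \<psi> g + l" "\<And>g. L.average \<psi> g = \<psi> g + l"
    by (rule exists_biharmonic[OF l(2)]) (rule that)
  have completion: "has_bochner_integral (completion \<mu>) f (\<integral>x. f x \<partial>\<mu>)" if "integrable \<mu> f"
    for f :: "'a \<Rightarrow> real"
    using that by (auto simp: has_bochner_integral_iff integrable_completion integral_completion)
  have "\<bar>\<psi> (g + h) - \<psi> g - \<psi> h\<bar> \<le> D + 3 * C" for g h
    using D[of g h] bounded_perturbations_bound[OF \<psi>(1), of g]
      bounded_perturbations_bound[OF \<psi>(1), of h] bounded_perturbations_bound[OF \<psi>(1), of "g + h"]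
    by linarith
  then have "quasimorphism \<psi>"
    unfolding quasimorphism_def by (intro bdd_aboveI[of _ "D + 3 * C"]) auto
  moreover have "universally_measurable_map borel borel \<psi>"
    by (rule measurable_imp_universally_measurable_map[OF bounded_perturbations_measurable[OF \<psi>(1)]])
  moreover have "equivalent_qm \<psi> \<phi>"
    unfolding equivalent_qm_def
    using bounded_perturbations_bound[OF \<psi>(1)] by (intro bdd_aboveI[of _ C]) auto
  moreover have "integrable (completion \<mu>) \<psi>"
    using completion[OF R.integrable_translate[OF \<psi>(1), of 0]] by (simp add: has_bochner_integral_iff)
  moreover have "has_bochner_integral (completion \<mu>) (\<lambda>k. \<psi> (g + k)) (\<psi> g + distortion \<mu> \<phi>)" for g
    using completion[OF R.integrable_translate[OF \<psi>(1), of g]] \<psi>(2)[of g] distortion_eq[OF l(1)]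
    by (simp add: R.average_def)
  moreover have "has_bochner_integral (completion \<mu>) (\<lambda>k. \<psi> (k + g)) (\<psi> g + distortion \<mu> \<phi>)" for g
    using completion[OF L.integrable_translate[OF \<psi>(1), of g]] \<psi>(3)[of g] distortion_eq[OF l(1)]
    by (simp add: L.average_def)
  ultimately show ?thesis by blast
qed

end
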